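(* Suppose that the following two conditions hold. (C1) $\mathcal C$ is dense in $L^2(E,\nu)$. (C2) For every $g\in\mathcal C\cap B_b(E)$ and $\beta>0$ there is a $u\in\mathcal C$ with $G_\beta g=u$ $\nu$-a.e., and for every $n\in\mathbb N$ there is a $v_n\in\mathcal C$ with $G_{n,\beta}g=v_n$ $\nu_n$-a.e. Suppose furthermore that $S_n$, $n\in\mathbb N$, converges to $S$, i.e. the following three conditions hold. (i) For every $\varphi\in L^2(E,\nu)$, every subsequence $n_k$, $k\in\mathbb N$, of indices, and every subsequence $\varphi_{n_k}\in\mathcal C$, $k\in\mathbb N$, $w$-converging to $\varphi$, we have $S(\varphi,\varphi)\le\liminf_{k\to\infty}S_{n_k}(\varphi_{n_k},\varphi_{n_k})$. (ii) For every $\psi\in D(S)$ there exists a sequence $\psi_n\in D(S_n)\cap\mathcal C$, $n\in\mathbb N$, $s$-converging to $\psi$ such that $\limsup_{n\to\infty}S_n(\psi_n,\psi_n)\le S(\psi,\psi)$. (iii) For every $g\in\mathcal C\cap B_b(E)$, every $\beta>0$, every $\psi\in D(S)$ and every sequence $\psi_n\in D(S_n)\cap\mathcal C$, $n\in\mathbb N$, $s$-converging to $\psi$ with $\limsup_{n\to\infty}S_n(\psi_n,\psi_n)\le S(\psi,\psi)$, we have $\lim_{n\to\infty}S_{n,\beta}(\psi_n,G_{n,\beta}g)=S_\beta(\psi,G_\beta g)$. Then, for all $g\in\mathcal C\cap B_b(E)$ and $\beta>0$, $G_{n,\beta}g$ $s$-converges to $G_\beta g$ as $n\to\infty$.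
   Context: Let $(E,\mathcal B)$ be a measurable space and let $\nu_n$, $n\in\mathbb N$, and $\nu$ be mutually orthogonal (mutually singular) probability measures on it, where $\nu$ has a countable base (so that $L^2(E,\nu)$ is separable). There are pairwise disjoint $E_n\subseteq E$, $n\in\mathbb N$, with $\nu_n(E\setminus E_n)=0$. $B_b(E)$ is the set of bounded measurable functions on $E$. $\langle\cdot,\cdot\rangle_n$ and $\langle\cdot,\cdot\rangle$ are the inner products of $L^2(E,\nu_n)$ and $L^2(E,\nu)$. Let $\alpha_n>0$, $n\ge0$, $\sum_{n\ge 0}\alpha_n=1$, and $\mathbb M:=\alpha_0\nu+\sum_{n\ge1}\alpha_n\nu_n$. Elements of $\bigcap_nL^2(E,\nu_n)\cap L^2(E,\nu)$ are $\mathbb M$-a.e. equivalence classes of everywhere defined $\mathcal B$-measurable functions $u$ with $\int u^2\,d\nu_n<\infty$ for all $n$ and $\int u^2\,d\nu<\infty$. Let $\mathcal D:=\{u\in\bigcap_nL^2(E,\nu_n)\cap L^2(E,\nu):\langle u,u\rangle_n\to\langle u,u\rangle \text{ as } n\to\infty\}$, and let $\mathcal C\subseteq\mathcal D$ be a fixed linear subset. A sequence $\varphi_n\in\mathcal C$ is $w$-convergent to $\varphi\in L^2(E,\nu)$ if $\langle\varphi_n,\psi\rangle_n\to\langle\varphi,\psi\rangle$ for all $\psi\in\mathcal C$. It is $s$-convergent to $\varphi$ if it is $w$-convergent to $\varphi$ and $\langle\varphi_n,\varphi_n\rangle_n\to\langle\varphi,\varphi\rangle$. For subsequences $\varphi_{n_k}$,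 $n$ is replaced with $n_k$. Resolvents $G_{n,\beta}g$ are identified with the elements of $\mathcal C$ that equal them $\nu_n$-a.e. For each $n$ let $(T_{n,t})_{t\ge0}$ be a strongly continuous semigroup of linear operators in $L^2(E,\nu_n)$ which possesses a transition probability function (i.e. $T_{n,t}f=\int f(y)\,P_n(t,\cdot,dy)$) and has $\nu_n$ as an invariant measure ($\int T_{n,t}f\,d\nu_n=\int f\,d\nu_n$ for $f\in L^\infty(E,\nu_n)$, $t\ge0$). Let $(T^b_t)_{t\ge0}$ be a semigroup in $B_b(E)$ possessing a transition probability function, by means of which it induces a strongly continuous contraction semigroup $(T_t)_{t\ge0}$ in $L^2(E,\nu)$; $\nu$ need not be invariant for it. Let $A_n$, $A$ be the generators and $G_{n,\beta}=(\beta-A_n)^{-1}$, $G_\beta=(\beta-A)^{-1}$, $\beta>0$, the resolvents. The form $S$ is defined by $D(S):=\{u\in L^2(E,\nu):\lim_{t\to0}\langle\frac1t(u-T_tu),v\rangle\text{ exists for all }v\in L^2(E,\nu)\}$ and $S(u,v):=\lim_{t\to0}\langle\frac1t(u-T_tu),v\rangle$ for $u\in D(S)$, $v\in L^2(E,\nu)$; one has $D(S)=D(A)$, $S(u,v)=-\langle Au,v\rangle$. Set $S(u,v):=\infty$ if $u\in L^2(E,\nu)\setminus D(S)$. The form $S_n$ on $L^2(E,\nu_n)$ is defined in the same way from $(T_{n,t})_{t\ge0}$. For $\beta>0$, $S_{n,\beta}(\varphi,\psi):=\beta\langle\varphi,\psi\rangle_n+S_n(\varphi,\psi)$ and $S_\beta(\varphi,\psi):=\beta\langle\varphi,\psi\rangle+S(\varphi,\psi)$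 (equal to $\infty$ when $S_n$, respectively $S$, is $\infty$). *)

theory Defs
  imports "HOL-Probability.Probability"
begin

definition mutually_singular :: "'a measure \<Rightarrow> 'a measure \<Rightarrow> bool" where
  "mutually_singular M N \<longleftrightarrow>
     (\<exists>A\<in>sets M. A \<in> sets N \<and> emeasure M A = 0 \<and> emeasure N (space N - A) = 0)"

definition has_countable_base :: "'a measure \<Rightarrow> bool" where
  "has_countable_base M \<longleftrightarrow>
     (\<exists>\<A>. countable \<A> \<and> \<A> \<subseteq> sets M \<and>
        (\<forall>B\<in>sets M. \<forall>e>0. \<exists>A\<in>\<A>. measure M ((A - B) \<union> (B - A)) < e))"

text \<open>
  The measure \<open>a 0 * N + (\<Sum>n. a (n + 1) * Ns n)\<close>.  The sequence of measures is indexed from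
  \<open>0\<close>, so \<open>Ns n\<close> is the measure with weight \<open>a (n + 1)\<close>.
\<close>

definition mixture :: "(nat \<Rightarrow> real) \<Rightarrow> 'a measure \<Rightarrow> (nat \<Rightarrow> 'a measure) \<Rightarrow> 'a measure" where
  "mixture a N Ns = measure_of (space N) (sets N)
     (\<lambda>A. ennreal (a 0) * emeasure N A + (\<Sum>n. ennreal (a (Suc n)) * emeasure (Ns n) A))"

lemma emeasure_mixture:
  assumes s: "\<And>n. sets (Ns n) = sets N" and A: "A \<in> sets N"
  shows "emeasure (mixture a N Ns) A =
    ennreal (a 0) * emeasure N A + (\<Sum>n. ennreal (a (Suc n)) * emeasure (Ns n) A)"
proof (rule emeasure_measure_of[OF mixture_def])
  show "sets N \<subseteq> Pow (space N)" by (rule sets.space_closed)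
  show "A \<in> sets (mixture a N Ns)"
    using A by (simp add: mixture_def)
  show "positive (sets (mixture a N Ns))
     (\<lambda>A. ennreal (a 0) * emeasure N A + (\<Sum>n. ennreal (a (Suc n)) * emeasure (Ns n) A))"
    by (simp add: positive_def)
  show "countably_additive (sets (mixture a N Ns))
     (\<lambda>A. ennreal (a 0) * emeasure N A + (\<Sum>n. ennreal (a (Suc n)) * emeasure (Ns n) A))"
  proof (rule countably_additiveI)
    fix F :: "nat \<Rightarrow> 'a set"
    assume "range F \<subseteq> sets (mixture a N Ns)" and d: "disjoint_family F"
    then have F: "range F \<subseteq> sets N" by (simp add: mixture_def)
    have "(\<Sum>i. ennreal (a 0) * emeasure N (F i) +
            (\<Sum>n. ennreal (a (Suc n)) * emeasure (Ns n) (F i)))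
        = (\<Sum>i. ennreal (a 0) * emeasure N (F i)) +
          (\<Sum>i. \<Sum>n. ennreal (a (Suc n)) * emeasure (Ns n) (F i))"
      by (rule suminf_add[symmetric]) auto
    also have "(\<Sum>i. \<Sum>n. ennreal (a (Suc n)) * emeasure (Ns n) (F i))
        = (\<Sum>n. \<Sum>i. ennreal (a (Suc n)) * emeasure (Ns n) (F i))"
      by (subst (1 3) nn_integral_count_space_nat[symmetric]) (rule nn_integral_suminf, simp)
    finally show "(\<Sum>i. ennreal (a 0) * emeasure N (F i) +
            (\<Sum>n. ennreal (a (Suc n)) * emeasure (Ns n) (F i)))
        = ennreal (a 0) * emeasure N (\<Union>i. F i) +
          (\<Sum>n. ennreal (a (Suc n)) * emeasure (Ns n) (\<Union>i. F i))"
      using F d s by (simp add: suminf_emeasure)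
  qed
qed

text \<open>
  Elements of \<open>L\<^sup>2\<close> are represented by everywhere defined measurable functions; equality in \<open>L\<^sup>2\<close>
  is written out as equality almost everywhere.
\<close>

definition L2 :: "'a measure \<Rightarrow> ('a \<Rightarrow> real) set" where
  "L2 M = {u \<in> borel_measurable M. integrable M (\<lambda>x. (u x)\<^sup>2)}"

definition ip :: "'a measure \<Rightarrow> ('a \<Rightarrow> real) \<Rightarrow> ('a \<Rightarrow> real) \<Rightarrow> real" where
  "ip M u v = (\<integral>x. u x * v x \<partial>M)"

definition nrm :: "'a measure \<Rightarrow> ('a \<Rightarrow> real) \<Rightarrow> real" where
  "nrm M u = sqrt (ip M u u)"

definition dense_in_L2 :: "('a \<Rightarrow> real) set \<Rightarrow> 'a measure \<Rightarrow> bool" where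
  "dense_in_L2 C M \<longleftrightarrow> C \<subseteq> L2 M \<and> (\<forall>u\<in>L2 M. \<forall>e>0. \<exists>v\<in>C. nrm M (\<lambda>x. u x - v x) < e)"

definition bounded_measurable :: "'a measure \<Rightarrow> ('a \<Rightarrow> real) set" where
  "bounded_measurable M = {f \<in> borel_measurable M. \<exists>K. \<forall>x\<in>space M. \<bar>f x\<bar> \<le> K}"

definition Linf :: "'a measure \<Rightarrow> ('a \<Rightarrow> real) set" where
  "Linf M = {f \<in> borel_measurable M. \<exists>K. AE x in M. \<bar>f x\<bar> \<le> K}"

definition norm_convergent_fns :: "'a measure \<Rightarrow> (nat \<Rightarrow> 'a measure) \<Rightarrow> ('a \<Rightarrow> real) set" where
  "norm_convergent_fns N Ns =
     {u. u \<in> L2 N \<and> (\<forall>n. u \<in> L2 (Ns n)) \<and> (\<lambda>n. ip (Ns n) u u) \<longlonglongrightarrow> ip N u u}"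

text \<open>
  A linear set of equivalence classes modulo \<open>M\<close>-a.e. equality, given as the set of all
  representatives of its elements.
\<close>

definition linear_class_set :: "'a measure \<Rightarrow> ('a \<Rightarrow> real) set \<Rightarrow> bool" where
  "linear_class_set M C \<longleftrightarrow>
     (\<lambda>x. 0) \<in> C \<and>
     (\<forall>u\<in>C. \<forall>v\<in>C. (\<lambda>x. u x + v x) \<in> C) \<and>
     (\<forall>u\<in>C. \<forall>c::real. (\<lambda>x. c * u x) \<in> C) \<and>
     (\<forall>u\<in>C. \<forall>v\<in>borel_measurable M. (AE x in M. u x = v x) \<longrightarrow> v \<in> C)"

text \<open>
  For a subsequence \<open>r\<close> of indices, these are used with \<open>\<lambda>k. Ns (r k)\<close> in place of \<open>Ns\<close>.
\<close>

definition w_converges ::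
  "('a \<Rightarrow> real) set \<Rightarrow> (nat \<Rightarrow> 'a measure) \<Rightarrow> 'a measure \<Rightarrow> (nat \<Rightarrow> 'a \<Rightarrow> real) \<Rightarrow> ('a \<Rightarrow> real) \<Rightarrow> bool" where
  "w_converges C Ns N f g \<longleftrightarrow>
     (\<forall>n. f n \<in> C) \<and> g \<in> L2 N \<and> (\<forall>v\<in>C. (\<lambda>n. ip (Ns n) (f n) v) \<longlonglongrightarrow> ip N g v)"

definition s_converges ::
  "('a \<Rightarrow> real) set \<Rightarrow> (nat \<Rightarrow> 'a measure) \<Rightarrow> 'a measure \<Rightarrow> (nat \<Rightarrow> 'a \<Rightarrow> real) \<Rightarrow> ('a \<Rightarrow> real) \<Rightarrow> bool" where
  "s_converges C Ns N f g \<longleftrightarrow>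
     w_converges C Ns N f g \<and> (\<lambda>n. ip (Ns n) (f n) (f n)) \<longlonglongrightarrow> ip N g g"

definition linear_operator_L2 :: "'a measure \<Rightarrow> (('a \<Rightarrow> real) \<Rightarrow> 'a \<Rightarrow> real) \<Rightarrow> bool" where
  "linear_operator_L2 M L \<longleftrightarrow>
     (\<forall>u\<in>L2 M. L u \<in> L2 M) \<and>
     (\<forall>u\<in>L2 M. \<forall>v\<in>L2 M. (AE x in M. u x = v x) \<longrightarrow> (AE x in M. L u x = L v x)) \<and>
     (\<forall>u\<in>L2 M. \<forall>v\<in>L2 M. AE x in M. L (\<lambda>y. u y + v y) x = L u x + L v x) \<and>
     (\<forall>u\<in>L2 M. \<forall>c::real. AE x in M. L (\<lambda>y. c * u y) x = c * L u x)"

definition strongly_continuous_semigroup ::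
  "'a measure \<Rightarrow> (real \<Rightarrow> ('a \<Rightarrow> real) \<Rightarrow> 'a \<Rightarrow> real) \<Rightarrow> bool" where
  "strongly_continuous_semigroup M T \<longleftrightarrow>
     (\<forall>t\<ge>0. linear_operator_L2 M (T t)) \<and>
     (\<forall>t\<ge>0. \<exists>K. \<forall>u\<in>L2 M. nrm M (T t u) \<le> K * nrm M u) \<and>
     (\<forall>u\<in>L2 M. AE x in M. T 0 u x = u x) \<and>
     (\<forall>s\<ge>0. \<forall>t\<ge>0. \<forall>u\<in>L2 M. AE x in M. T (s + t) u x = T s (T t u) x) \<and>
     (\<forall>u\<in>L2 M. ((\<lambda>t. nrm M (\<lambda>x. T t u x - u x)) \<longlongrightarrow> 0) (at_right 0))"

definition contraction_semigroup ::
  "'a measure \<Rightarrow> (real \<Rightarrow> ('a \<Rightarrow> real) \<Rightarrow> 'a \<Rightarrow> real) \<Rightarrow> bool" where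
  "contraction_semigroup M T \<longleftrightarrow>
     strongly_continuous_semigroup M T \<and> (\<forall>t\<ge>0. \<forall>u\<in>L2 M. nrm M (T t u) \<le> nrm M u)"

definition transition_kernel :: "'a measure \<Rightarrow> (real \<Rightarrow> 'a \<Rightarrow> 'a measure) \<Rightarrow> bool" where
  "transition_kernel M P \<longleftrightarrow> (\<forall>t\<ge>0. P t \<in> measurable M (prob_algebra M))"

definition L2_transition_function ::
  "'a measure \<Rightarrow> (real \<Rightarrow> ('a \<Rightarrow> real) \<Rightarrow> 'a \<Rightarrow> real) \<Rightarrow> (real \<Rightarrow> 'a \<Rightarrow> 'a measure) \<Rightarrow> bool" where
  "L2_transition_function M T P \<longleftrightarrow>
     transition_kernel M P \<and>
     (\<forall>t\<ge>0. \<forall>f\<in>L2 M. AE x in M. integrable (P t x) f \<and> T t f x = (\<integral>y. f y \<partial>P t x))"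

definition invariant_measure ::
  "'a measure \<Rightarrow> (real \<Rightarrow> ('a \<Rightarrow> real) \<Rightarrow> 'a \<Rightarrow> real) \<Rightarrow> bool" where
  "invariant_measure M T \<longleftrightarrow>
     (\<forall>t\<ge>0. \<forall>f\<in>Linf M. (\<integral>x. T t f x \<partial>M) = (\<integral>x. f x \<partial>M))"

definition Bb_semigroup ::
  "'a measure \<Rightarrow> (real \<Rightarrow> ('a \<Rightarrow> real) \<Rightarrow> 'a \<Rightarrow> real) \<Rightarrow> bool" where
  "Bb_semigroup M T \<longleftrightarrow>
     (\<forall>t\<ge>0. \<forall>f\<in>bounded_measurable M. T t f \<in> bounded_measurable M) \<and>
     (\<forall>t\<ge>0. \<forall>f\<in>bounded_measurable M. \<forall>g\<in>bounded_measurable M. \<forall>x\<in>space M.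
        T t (\<lambda>y. f y + g y) x = T t f x + T t g x) \<and>
     (\<forall>t\<ge>0. \<forall>f\<in>bounded_measurable M. \<forall>c::real. \<forall>x\<in>space M.
        T t (\<lambda>y. c * f y) x = c * T t f x) \<and>
     (\<forall>f\<in>bounded_measurable M. \<forall>x\<in>space M. T 0 f x = f x) \<and>
     (\<forall>s\<ge>0. \<forall>t\<ge>0. \<forall>f\<in>bounded_measurable M. \<forall>x\<in>space M. T (s + t) f x = T s (T t f) x)"

definition Bb_transition_function ::
  "'a measure \<Rightarrow> (real \<Rightarrow> ('a \<Rightarrow> real) \<Rightarrow> 'a \<Rightarrow> real) \<Rightarrow> (real \<Rightarrow> 'a \<Rightarrow> 'a measure) \<Rightarrow> bool" where
  "Bb_transition_function M T P \<longleftrightarrow>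
     transition_kernel M P \<and>
     (\<forall>t\<ge>0. \<forall>f\<in>bounded_measurable M. \<forall>x\<in>space M. T t f x = (\<integral>y. f y \<partial>P t x))"

definition strong_derivative_at_0 ::
  "'a measure \<Rightarrow> (real \<Rightarrow> ('a \<Rightarrow> real) \<Rightarrow> 'a \<Rightarrow> real) \<Rightarrow> ('a \<Rightarrow> real) \<Rightarrow> ('a \<Rightarrow> real) \<Rightarrow> bool" where
  "strong_derivative_at_0 M T u w \<longleftrightarrow>
     w \<in> L2 M \<and> ((\<lambda>t. nrm M (\<lambda>x. (T t u x - u x) / t - w x)) \<longlongrightarrow> 0) (at_right 0)"

definition gen_dom ::
  "'a measure \<Rightarrow> (real \<Rightarrow> ('a \<Rightarrow> real) \<Rightarrow> 'a \<Rightarrow> real) \<Rightarrow> ('a \<Rightarrow> real) set" where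
  "gen_dom M T = {u \<in> L2 M. \<exists>w. strong_derivative_at_0 M T u w}"

text \<open>
  The choice operator below selects a representative: the limit in \<open>gen\<close>, and the solution of
  \<open>(b - A) u = g\<close> in \<open>resolvent\<close>, are unique up to a.e. equality.
\<close>

definition gen ::
  "'a measure \<Rightarrow> (real \<Rightarrow> ('a \<Rightarrow> real) \<Rightarrow> 'a \<Rightarrow> real) \<Rightarrow> ('a \<Rightarrow> real) \<Rightarrow> 'a \<Rightarrow> real" where
  "gen M T u = (SOME w. strong_derivative_at_0 M T u w)"

definition resolvent ::
  "'a measure \<Rightarrow> (real \<Rightarrow> ('a \<Rightarrow> real) \<Rightarrow> 'a \<Rightarrow> real) \<Rightarrow> real \<Rightarrow> ('a \<Rightarrow> real) \<Rightarrow> 'a \<Rightarrow> real" where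
  "resolvent M T b g =
     (SOME u. u \<in> gen_dom M T \<and> (AE x in M. b * u x - gen M T u x = g x))"

definition form_dom ::
  "'a measure \<Rightarrow> (real \<Rightarrow> ('a \<Rightarrow> real) \<Rightarrow> 'a \<Rightarrow> real) \<Rightarrow> ('a \<Rightarrow> real) set" where
  "form_dom M T = {u \<in> L2 M. \<forall>v\<in>L2 M. \<exists>l.
     ((\<lambda>t. ip M (\<lambda>x. (u x - T t u x) / t) v) \<longlongrightarrow> l) (at_right 0)}"

definition form ::
  "'a measure \<Rightarrow> (real \<Rightarrow> ('a \<Rightarrow> real) \<Rightarrow> 'a \<Rightarrow> real) \<Rightarrow> ('a \<Rightarrow> real) \<Rightarrow> ('a \<Rightarrow> real) \<Rightarrow> ereal" where
  "form M T u v =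
     (if u \<in> form_dom M T
      then ereal (Lim (at_right 0) (\<lambda>t. ip M (\<lambda>x. (u x - T t u x) / t) v))
      else \<infinity>)"

definition form_shift ::
  "'a measure \<Rightarrow> (real \<Rightarrow> ('a \<Rightarrow> real) \<Rightarrow> 'a \<Rightarrow> real) \<Rightarrow> real \<Rightarrow> ('a \<Rightarrow> real) \<Rightarrow> ('a \<Rightarrow> real) \<Rightarrow> ereal" where
  "form_shift M T b u v = ereal (b * ip M u v) + form M T u v"

end

theory Submission
  imports Defs
begin

text \<open>
  Write \<open>u\<close> for the resolvent of \<open>T\<close> at \<open>g\<close> and \<open>v n\<close> for that of \<open>Ts n\<close>. Invariance and Jensen's
  inequality make \<open>Ts n\<close> contractive, so the \<open>v n\<close> are bounded in norm and, since \<open>L\<^sup>2\<close> of the limit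
  measure is separable, every subsequence has a further \<open>w\<close>-convergent one, with limit \<open>\<phi>\<close> say.
  Condition (i) puts \<open>\<phi>\<close> in the domain of the form. Let \<open>\<eta> = \<phi> - u\<close>, and let \<open>B(x,y)\<close> be
  \<open>\<beta>\<close> times the scalar product plus the form. For \<open>\<psi> = u + s \<eta>\<close> take \<open>\<psi>s n\<close> as in (ii), expand the
  form at \<open>v n - \<psi>s n\<close>, apply (iii) to the only mixed term that the resolvent equation does not
  evaluate, and apply (i) to \<open>v n - \<psi>s n\<close>. The result is \<open>(1 - 2s) B(\<eta>,\<eta>) \<le> \<langle>g,\<eta>\<rangle>\<close> for all real
  \<open>s\<close>, hence \<open>B(\<eta>,\<eta>) \<le> 0\<close> and \<open>\<phi> = u\<close> almost everywhere. The same expansion with \<open>\<psi> = u\<close> shows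
  that \<open>v n - \<psi>s n\<close> tends to \<open>0\<close> in norm, which gives convergence of the norms.
\<close>

section \<open>Square-integrable functions\<close>

text \<open>The spaces \<open>L2 (\<nu>s n)\<close> change with \<open>n\<close>, so there is no
  common Hilbert space. Sequences are compared only through their pairings with \<open>C\<close>,
  and an estimate in \<nu> passes to \<open>\<nu>s n\<close> only for elements of \<open>C\<close>,
  because their norms converge. The forms need not be symmetric. The resolvent equation evaluates a
  form whose first argument is the resolvent; with the resolvent in second place the value comes
  from (iii), which speaks only of recovery sequences of elements of the form domain. For a w-limit,
  (i) gives just a one-sided bound. Hence a single test element \<psi> leaves the pairing of g with
  \<eta>, of unknown sign, on the right. Along the line u + s \<eta> the terms s^2 B(\<eta>,\<eta>)
  on both sides cancel; what remains is linear in s, and s may be taken arbitrarily negative.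
  \<open>gen\<close> and \<open>resolvent\<close> are choices, so a solution of (b - A) u = g has to
  be constructed before anything can be said about them.\<close>

lemma L2_measurable [measurable_dest]: "u \<in> L2 M \<Longrightarrow> u \<in> borel_measurable M"
  by (simp add: L2_def)

lemma L2_integrable_square: "u \<in> L2 M \<Longrightarrow> integrable M (\<lambda>x. (u x)\<^sup>2)"
  by (simp add: L2_def)

lemma L2_integrable_mult:
  assumes "u \<in> L2 M" "v \<in> L2 M"
  shows "integrable M (\<lambda>x. u x * v x)"
proof (rule Bochner_Integration.integrable_bound)
  show "integrable M (\<lambda>x. (u x)\<^sup>2 + (v x)\<^sup>2)"
    using assms by (intro Bochner_Integration.integrable_add L2_integrable_square)
  show "(\<lambda>x. u x * v x) \<in> borel_measurable M"
    using L2_measurable[OF assms(1)] L2_measurable[OF assms(2)] by measurable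
  have "\<bar>a * b\<bar> \<le> a\<^sup>2 + b\<^sup>2" for a b :: real
  proof -
    have "2 * (\<bar>a\<bar> * \<bar>b\<bar>) \<le> a\<^sup>2 + b\<^sup>2"
      using sum_squares_bound[of "\<bar>a\<bar>" "\<bar>b\<bar>"] by (simp add: mult.assoc)
    moreover have "0 \<le> \<bar>a\<bar> * \<bar>b\<bar>" by simp
    ultimately show ?thesis unfolding abs_mult by linarith
  qed
  then show "AE x in M. norm (u x * v x) \<le> norm ((u x)\<^sup>2 + (v x)\<^sup>2)"
    by simp
qed

lemma L2_scale [simp]: "u \<in> L2 M \<Longrightarrow> (\<lambda>x. c * u x) \<in> L2 M" for c :: real
  by (auto simp: L2_def power_mult_distrib)

lemma L2_add [simp]:
  assumes "u \<in> L2 M" "v \<in> L2 M"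
  shows "(\<lambda>x. u x + v x) \<in> L2 M"
proof -
  have "integrable M (\<lambda>x. (u x)\<^sup>2 + 2 * (u x * v x) + (v x)\<^sup>2)"
    using assms by (intro Bochner_Integration.integrable_add Bochner_Integration.integrable_mult_right
        L2_integrable_square L2_integrable_mult)
  moreover have "(u x)\<^sup>2 + 2 * (u x * v x) + (v x)\<^sup>2 = (u x + v x)\<^sup>2" for x
    by (simp add: power2_sum)
  ultimately show ?thesis
    using assms by (auto simp: L2_def)
qed

lemma L2_diff [simp]: "u \<in> L2 M \<Longrightarrow> v \<in> L2 M \<Longrightarrow> (\<lambda>x. u x - v x) \<in> L2 M"
  using L2_add[of u M "\<lambda>x. -1 * v x"] L2_scale[of v M "-1"] by simp

lemma L2_divide [simp]: "u \<in> L2 M \<Longrightarrow> (\<lambda>x. u x / c) \<in> L2 M" for c :: real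
  using L2_scale[of u M "inverse c"] by (simp add: field_simps)

lemma L2_zero [simp]: "(\<lambda>x. 0) \<in> L2 M"
  by (simp add: L2_def)

lemma ip_commute: "ip M u v = ip M v u"
  by (simp add: ip_def mult.commute)

lemma ip_add_left:
  "u \<in> L2 M \<Longrightarrow> v \<in> L2 M \<Longrightarrow> w \<in> L2 M \<Longrightarrow> ip M (\<lambda>x. u x + v x) w = ip M u w + ip M v w"
  by (simp add: ip_def distrib_right L2_integrable_mult)

lemma ip_diff_left:
  "u \<in> L2 M \<Longrightarrow> v \<in> L2 M \<Longrightarrow> w \<in> L2 M \<Longrightarrow> ip M (\<lambda>x. u x - v x) w = ip M u w - ip M v w"
  by (simp add: ip_def left_diff_distrib L2_integrable_mult)

lemma ip_scale_left: "ip M (\<lambda>x. c * u x) w = c * ip M u w"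
  by (simp add: ip_def mult.assoc)

lemma ip_divide_left: "ip M (\<lambda>x. u x / c) w = ip M u w / c"
  using ip_scale_left[of M "inverse c" u w] by (simp add: field_simps)

lemma ip_add_right:
  "u \<in> L2 M \<Longrightarrow> v \<in> L2 M \<Longrightarrow> w \<in> L2 M \<Longrightarrow> ip M w (\<lambda>x. u x + v x) = ip M w u + ip M w v"
  by (simp add: ip_commute[of M w] ip_add_left)

lemma ip_diff_right:
  "u \<in> L2 M \<Longrightarrow> v \<in> L2 M \<Longrightarrow> w \<in> L2 M \<Longrightarrow> ip M w (\<lambda>x. u x - v x) = ip M w u - ip M w v"
  by (simp add: ip_commute[of M w] ip_diff_left)

lemma ip_scale_right: "ip M w (\<lambda>x. c * u x) = c * ip M w u"
  by (simp add: ip_commute[of M w] ip_scale_left)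

lemmas ip_linear = ip_add_left ip_diff_left ip_scale_left ip_add_right ip_diff_right ip_scale_right

lemma ip_self_nonneg: "ip M u u \<ge> 0"
  by (simp add: ip_def)

lemma ip_cong_AE:
  assumes "u \<in> borel_measurable M" "u' \<in> borel_measurable M" "AE x in M. u x = u' x"
    and "w \<in> borel_measurable M"
  shows "ip M u w = ip M u' w"
  unfolding ip_def using assms by (intro integral_cong_AE) auto

lemma nrm_nonneg [simp]: "nrm M u \<ge> 0"
  by (simp add: nrm_def ip_self_nonneg)

lemma nrm_square: "(nrm M u)\<^sup>2 = ip M u u"
  by (simp add: nrm_def ip_self_nonneg)

lemma nrm_scale: "nrm M (\<lambda>x. c * u x) = \<bar>c\<bar> * nrm M u"
  by (simp add: nrm_def ip_scale_left ip_scale_right real_sqrt_mult flip: mult.assoc)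

lemma nrm_diff_commute: "nrm M (\<lambda>x. u x - v x) = nrm M (\<lambda>x. v x - u x)"
  using nrm_scale[of M "-1" "\<lambda>x. u x - v x"] by simp

lemma nrm_cong_AE:
  assumes "u \<in> borel_measurable M" "u' \<in> borel_measurable M" "AE x in M. u x = u' x"
  shows "nrm M u = nrm M u'"
  using ip_cong_AE[OF assms assms(1)] ip_cong_AE[OF assms assms(2)]
  by (simp add: nrm_def ip_commute)

text \<open>The square of s u - t v has nonnegative integral. At s = (v,v), t = (u,v) this is the
  claim multiplied by (v,v). If (v,v) = 0, the expression is affine in t, which forces (u,v) =
  0.\<close>

lemma ip_Cauchy_Schwarz:
  assumes u: "u \<in> L2 M" and v: "v \<in> L2 M"
  shows "\<bar>ip M u v\<bar> \<le> nrm M u * nrm M v"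
proof -
  let ?a = "ip M u u" and ?b = "ip M u v" and ?c = "ip M v v"
  have q: "0 \<le> ?a * s\<^sup>2 - 2 * ?b * s * t + ?c * t\<^sup>2" for s t
    using ip_self_nonneg[of M "\<lambda>x. s * u x - t * v x"] u v
    by (simp add: ip_linear ip_commute[of M v u] power2_eq_square algebra_simps)
  have "?b\<^sup>2 \<le> ?a * ?c"
  proof (cases "?c = 0")
    case True
    have "?b = 0"
    proof (rule ccontr)
      assume b: "?b \<noteq> 0"
      \<comment> \<open>This \<open>t\<close> is chosen to make the affine expression equal to
        -1.\<close>
      have "0 \<le> ?a - 2 * ?b * ((?a + 1) / (2 * ?b))"
        using q[of 1 "(?a + 1) / (2 * ?b)"] True by simp
      also have "2 * ?b * ((?a + 1) / (2 * ?b)) = ?a + 1"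
        using b by simp
      finally show False by simp
    qed
    then show ?thesis using True by simp
  next
    case False
    then have c: "?c > 0" using ip_self_nonneg[of M v] by simp
    have "0 \<le> ?c * (?a * ?c - ?b\<^sup>2)"
      using q[of ?c ?b] by (simp add: power2_eq_square algebra_simps)
    then show ?thesis using c by (simp add: zero_le_mult_iff)
  qed
  then have "\<bar>?b\<bar> \<le> sqrt (?a * ?c)"
    using real_sqrt_le_mono[of "?b\<^sup>2"] by simp
  then show ?thesis by (simp add: nrm_def real_sqrt_mult)
qed

lemma nrm_triangle:
  assumes u: "u \<in> L2 M" and v: "v \<in> L2 M"
  shows "nrm M (\<lambda>x. u x + v x) \<le> nrm M u + nrm M v"
proof (rule power2_le_imp_le)
  have "(nrm M (\<lambda>x. u x + v x))\<^sup>2 = (nrm M u)\<^sup>2 + 2 * ip M u v + (nrm M v)\<^sup>2"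
    using u v by (simp add: nrm_square ip_linear ip_commute[of M v u])
  then show "(nrm M (\<lambda>x. u x + v x))\<^sup>2 \<le> (nrm M u + nrm M v)\<^sup>2"
    using ip_Cauchy_Schwarz[OF u v] by (simp add: power2_sum)
qed simp

lemma nrm_triangle_diff:
  assumes "u \<in> L2 M" "v \<in> L2 M" "w \<in> L2 M"
  shows "nrm M (\<lambda>x. u x - w x) \<le> nrm M (\<lambda>x. u x - v x) + nrm M (\<lambda>x. v x - w x)"
  using nrm_triangle[of "\<lambda>x. u x - v x" M "\<lambda>x. v x - w x"] assms by simp

lemma nrm_reverse_triangle:
  assumes u: "u \<in> L2 M" and v: "v \<in> L2 M"
  shows "\<bar>nrm M u - nrm M v\<bar> \<le> nrm M (\<lambda>x. u x - v x)"
  using nrm_triangle[of "\<lambda>x. u x - v x" M v] nrm_triangle[of "\<lambda>x. v x - u x" M u] u v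
  by (simp add: nrm_diff_commute[of M v u])

lemma nrm_eq_0_AE:
  assumes "u \<in> L2 M" "nrm M u = 0"
  shows "AE x in M. u x = 0"
proof -
  have "(\<integral>x. (u x)\<^sup>2 \<partial>M) = 0"
    using assms(2) nrm_square[of M u] by (simp add: ip_def power2_eq_square)
  then show ?thesis
    using integral_nonneg_eq_0_iff_AE[OF L2_integrable_square[OF assms(1)]] by simp
qed

lemma nrm_diff_eq_0_AE:
  "u \<in> L2 M \<Longrightarrow> v \<in> L2 M \<Longrightarrow> nrm M (\<lambda>x. u x - v x) = 0 \<Longrightarrow> AE x in M. u x = v x"
  using nrm_eq_0_AE[of "\<lambda>x. u x - v x" M] by simp

lemma (in finite_measure) L2_bounded:
  assumes [measurable]: "f \<in> borel_measurable M" and b: "AE x in M. \<bar>f x\<bar> \<le> K"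
  shows "f \<in> L2 M"
proof -
  have "AE x in M. norm ((f x)\<^sup>2) \<le> K\<^sup>2"
    using b by eventually_elim (metis abs_ge_zero norm_power power_mono real_norm_def)
  then show ?thesis
    by (simp add: L2_def integrable_const_bound)
qed

lemma (in finite_measure) L2_indicator: "A \<in> sets M \<Longrightarrow> indicator A \<in> L2 M"
  by (auto intro!: L2_bounded[of _ 1] simp: indicator_def)

lemma (in finite_measure) L2_integrable:
  assumes "u \<in> L2 M"
  shows "integrable M u"
  using L2_integrable_mult[OF assms L2_bounded[of "\<lambda>x. 1" 1]] by simp

text \<open>Cauchy-Schwarz against the constant 1, which has norm 1. It turns \<open>L2\<close>
  Cauchy sequences into \<open>L1\<close> Cauchy sequences.\<close>

lemma (in prob_space) integral_abs_le_nrm: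
  assumes u: "u \<in> L2 M"
  shows "(\<integral>x. \<bar>u x\<bar> \<partial>M) \<le> nrm M u"
proof -
  have "(\<lambda>x. \<bar>u x\<bar>) \<in> L2 M" "(\<lambda>x. 1) \<in> L2 M"
    using u by (auto simp: L2_def)
  from ip_Cauchy_Schwarz[OF this] show ?thesis
    by (simp add: ip_def nrm_def prob_space)
qed

section \<open>Completeness and the Riesz representation\<close>

text \<open>The sequence is Cauchy in \<open>L1\<close>, so a subsequence converges almost
  everywhere; Fatou's lemma along that subsequence bounds the \<open>L2\<close> distance of every
  late term to the pointwise limit.\<close>

lemma (in prob_space) L2_complete:
  assumes f: "\<And>n. f n \<in> L2 M"
    and cau: "\<And>e. e > 0 \<Longrightarrow> \<exists>N. \<forall>i\<ge>N. \<forall>j\<ge>N. nrm M (\<lambda>x. f i x - f j x) < e"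
  shows "\<exists>u\<in>L2 M. (\<lambda>n. nrm M (\<lambda>x. f n x - u x)) \<longlonglongrightarrow> 0"
proof -
  have [measurable]: "f n \<in> borel_measurable M" for n
    using f by (rule L2_measurable)
  have "\<exists>N. \<forall>i\<ge>N. \<forall>j\<ge>N. (LINT x|M. norm (f i x - f j x)) < e" if e: "e > 0" for e
  proof -
    obtain N where N: "\<forall>i\<ge>N. \<forall>j\<ge>N. nrm M (\<lambda>x. f i x - f j x) < e"
      using cau[OF e] by blast
    have "(LINT x|M. norm (f i x - f j x)) < e" if "i \<ge> N" "j \<ge> N" for i j
    proof -
      have "(LINT x|M. norm (f i x - f j x)) \<le> nrm M (\<lambda>x. f i x - f j x)"
        using integral_abs_le_nrm[OF L2_diff[OF f f], of i j] by simp
      also have "\<dots> < e" using N that by blast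
      finally show ?thesis .
    qed
    then show ?thesis by blast
  qed
  then obtain r where r: "strict_mono r" and C: "AE x in M. Cauchy (\<lambda>i. f (r i) x)"
    using cauchy_L1_AE_cauchy_subseq[of M f, OF L2_integrable[OF f]] by blast
  define u where "u = (\<lambda>x. lim (\<lambda>i. f (r i) x))"
  have [measurable]: "u \<in> borel_measurable M"
    unfolding u_def by measurable
  have lim: "AE x in M. (\<lambda>i. f (r i) x) \<longlonglongrightarrow> u x"
    using C by eventually_elim (simp add: u_def Cauchy_convergent_iff convergent_LIMSEQ_iff)
  \<comment> \<open>Fatou with \<open>n\<close> fixed and the subsequence index running. Membership
    in \<open>L2\<close> comes from the same bound and is what later puts \<open>u\<close> itself
    into \<open>L2\<close>.\<close>
  have *: "(\<lambda>x. f n x - u x) \<in> L2 M \<and> nrm M (\<lambda>x. f n x - u x) \<le> e"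
    if e: "e > 0" and N: "\<forall>i\<ge>N. nrm M (\<lambda>x. f n x - f i x) < e" for n N and e :: real
  proof -
    have eq: "AE x in M. ennreal ((f n x - u x)\<^sup>2) = liminf (\<lambda>i. ennreal ((f n x - f (r i) x)\<^sup>2))"
      using lim
    proof eventually_elim
      case (elim x)
      have "(\<lambda>i. ennreal ((f n x - f (r i) x)\<^sup>2)) \<longlonglongrightarrow> ennreal ((f n x - u x)\<^sup>2)"
        by (intro tendsto_ennrealI tendsto_intros elim)
      then show ?case by (rule lim_imp_Liminf[OF sequentially_bot, symmetric])
    qed
    have b: "(\<integral>\<^sup>+x. ennreal ((f n x - f (r i) x)\<^sup>2) \<partial>M) \<le> ennreal (e\<^sup>2)" if "i \<ge> N" for i
    proof -
      have "(\<integral>\<^sup>+x. ennreal ((f n x - f (r i) x)\<^sup>2) \<partial>M) = ennreal (\<integral>x. (f n x - f (r i) x)\<^sup>2 \<partial>M)"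
        by (intro nn_integral_eq_integral L2_integrable_square L2_diff f) auto
      also have "(\<integral>x. (f n x - f (r i) x)\<^sup>2 \<partial>M) = (nrm M (\<lambda>x. f n x - f (r i) x))\<^sup>2"
        unfolding nrm_square by (simp add: ip_def power2_eq_square)
      also have "\<dots> \<le> e\<^sup>2"
        using N that seq_suble[OF r, of i] by (intro power_mono) (auto intro!: less_imp_le)
      finally show ?thesis by (simp add: ennreal_leI)
    qed
    have "(\<integral>\<^sup>+x. ennreal ((f n x - u x)\<^sup>2) \<partial>M)
        = (\<integral>\<^sup>+x. liminf (\<lambda>i. ennreal ((f n x - f (r i) x)\<^sup>2)) \<partial>M)"
      using eq by (rule nn_integral_cong_AE)
    also have "\<dots> \<le> liminf (\<lambda>i. \<integral>\<^sup>+x. ennreal ((f n x - f (r i) x)\<^sup>2) \<partial>M)"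
      by (rule nn_integral_liminf) measurable
    also have "\<dots> \<le> ennreal (e\<^sup>2)"
      by (intro Liminf_le) (auto simp: eventually_sequentially intro!: exI[of _ N] b)
    finally have bd: "(\<integral>\<^sup>+x. ennreal ((f n x - u x)\<^sup>2) \<partial>M) \<le> ennreal (e\<^sup>2)" .
    have int: "integrable M (\<lambda>x. (f n x - u x)\<^sup>2)"
      by (rule integrableI_bounded) (use bd in \<open>auto intro: le_less_trans\<close>)
    then have "ennreal (\<integral>x. (f n x - u x)\<^sup>2 \<partial>M) \<le> ennreal (e\<^sup>2)"
      using bd by (simp add: nn_integral_eq_integral)
    then have "(nrm M (\<lambda>x. f n x - u x))\<^sup>2 \<le> e\<^sup>2"
      unfolding nrm_square by (simp add: ip_def power2_eq_square)
    then show ?thesis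
      using int e by (auto simp: L2_def intro: power2_le_imp_le)
  qed
  obtain N1 where "\<forall>i\<ge>N1. \<forall>j\<ge>N1. nrm M (\<lambda>x. f i x - f j x) < 1"
    using cau[of 1] by auto
  then have "(\<lambda>x. f N1 x - u x) \<in> L2 M"
    using *[of 1 N1 N1] by auto
  then have u: "u \<in> L2 M"
    using L2_diff[OF f[of N1]] by fastforce
  moreover have "(\<lambda>n. nrm M (\<lambda>x. f n x - u x)) \<longlonglongrightarrow> 0"
  proof (rule LIMSEQ_I)
    fix e :: real assume e: "e > 0"
    then obtain N where N: "\<forall>i\<ge>N. \<forall>j\<ge>N. nrm M (\<lambda>x. f i x - f j x) < e/2"
      using cau[of "e/2"] by auto
    have "norm (nrm M (\<lambda>x. f n x - u x) - 0) < e" if "n \<ge> N" for n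
      using *[of "e/2" N n] N e that by auto
    then show "\<exists>N. \<forall>n\<ge>N. norm (nrm M (\<lambda>x. f n x - u x) - 0) < e" by blast
  qed
  ultimately show ?thesis by blast
qed

text \<open>The representing element minimises \<open>\<parallel>v\<parallel>\<^sup>2 - 2 l(v)\<close>; by the parallelogram law a minimising
  sequence in \<open>V\<close> is Cauchy.\<close>

lemma (in prob_space) L2_Riesz:
  assumes V: "V \<subseteq> L2 M" "(\<lambda>x. 0) \<in> V"
    and Vadd: "\<And>u v. u \<in> V \<Longrightarrow> v \<in> V \<Longrightarrow> (\<lambda>x. u x + v x) \<in> V"
    and Vscale: "\<And>u c. u \<in> V \<Longrightarrow> (\<lambda>x. c * u x) \<in> V"
    and ladd: "\<And>u v. u \<in> V \<Longrightarrow> v \<in> V \<Longrightarrow> l (\<lambda>x. u x + v x) = l u + l v"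
    and lscale: "\<And>u c. u \<in> V \<Longrightarrow> l (\<lambda>x. c * u x) = c * l u"
    and lbound: "\<And>u. u \<in> V \<Longrightarrow> \<bar>l u\<bar> \<le> K * nrm M u"
  shows "\<exists>w\<in>L2 M. \<forall>v\<in>V. l v = ip M w v"
proof -
  have VL: "v \<in> L2 M" if "v \<in> V" for v using V that by auto
  define F where "F = (\<lambda>v. ip M v v - 2 * l v)"
  have F_add: "F (\<lambda>x. u x + t * w x) = F u + 2 * t * (ip M u w - l w) + t\<^sup>2 * ip M w w"
    if "u \<in> V" "w \<in> V" for u w t
    using that by (simp add: F_def ladd lscale Vscale ip_linear VL ip_commute[of M w u]
        power2_eq_square algebra_simps)
  \<comment> \<open>Completing the square in \<open>nrm M v\<close>.\<close>
  have "F v \<ge> - K\<^sup>2" if "v \<in> V" for v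
  proof -
    have "F v \<ge> (nrm M v)\<^sup>2 - 2 * (K * nrm M v)"
      using lbound[OF that] by (auto simp: F_def nrm_square)
    moreover have "(nrm M v)\<^sup>2 - 2 * (K * nrm M v) + K\<^sup>2 = (nrm M v - K)\<^sup>2"
      by (simp add: power2_diff)
    ultimately show ?thesis using zero_le_power2[of "nrm M v - K"] by linarith
  qed
  then have bdd: "bdd_below (F ` V)" by (auto intro!: bdd_belowI2)
  define m where "m = Inf (F ` V)"
  have m_le: "m \<le> F v" if "v \<in> V" for v
    unfolding m_def using bdd that by (auto intro: cInf_lower)
  have "\<exists>v\<in>V. F v < m + inverse (Suc n)" for n
    using cInf_lessD[of "F ` V" "m + inverse (Suc n)"] V(2) by (auto simp: m_def)
  then obtain f where fV: "\<And>n. f n \<in> V" and fm: "\<And>n. F (f n) < m + inverse (Suc n)"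
    by metis
  have close: "(nrm M (\<lambda>x. f i x - f j x))\<^sup>2 \<le> 2 * inverse (Suc i) + 2 * inverse (Suc j)" for i j
  proof -
    have h: "(\<lambda>x. (1/2) * f i x + (1/2) * f j x) \<in> V"
      using fV by (intro Vadd Vscale)
    \<comment> \<open>The linear parts of \<open>F\<close> cancel here. The midpoint lies in
      \<open>V\<close>, so its value is at least \<open>m\<close>, while both \<open>F (f i)\<close>
      and \<open>F (f j)\<close> are nearly \<open>m\<close>.\<close>
    have "(nrm M (\<lambda>x. f i x - f j x))\<^sup>2
        = 2 * F (f i) + 2 * F (f j) - 4 * F (\<lambda>x. (1/2) * f i x + (1/2) * f j x)"
      using fV by (simp only: F_def ladd lscale Vscale ip_linear VL nrm_square L2_scale L2_diff L2_add)
        (simp add: ip_commute[of M "f j" "f i"] algebra_simps)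
    with m_le[OF h] fm[of i] fm[of j] show ?thesis by linarith
  qed
  have "\<exists>N. \<forall>i\<ge>N. \<forall>j\<ge>N. nrm M (\<lambda>x. f i x - f j x) < e" if e: "e > 0" for e
  proof -
    obtain N where N: "inverse (real (Suc N)) < e\<^sup>2 / 4"
      using reals_Archimedean[of "e\<^sup>2/4"] e by auto
    have "nrm M (\<lambda>x. f i x - f j x) < e" if "i \<ge> N" "j \<ge> N" for i j
    proof (rule power2_less_imp_less)
      have "inverse (real (Suc i)) \<le> inverse (real (Suc N))" "inverse (real (Suc j)) \<le> inverse (real (Suc N))"
        using that by (auto intro!: le_imp_inverse_le)
      then show "(nrm M (\<lambda>x. f i x - f j x))\<^sup>2 < e\<^sup>2"
        using close[of i j] N by linarith
    qed (use e in simp)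
    then show ?thesis by blast
  qed
  from L2_complete[OF VL[OF fV] this]
  obtain w where w: "w \<in> L2 M" and fw: "(\<lambda>n. nrm M (\<lambda>x. f n x - w x)) \<longlonglongrightarrow> 0" by blast
  have "l v = ip M w v" if v: "v \<in> V" for v
  proof -
    have "(\<lambda>n. ip M (f n) v - ip M w v) \<longlonglongrightarrow> 0"
    proof (rule Lim_null_comparison)
      show "\<forall>\<^sub>F n in sequentially. norm (ip M (f n) v - ip M w v) \<le> nrm M (\<lambda>x. f n x - w x) * nrm M v"
        using ip_Cauchy_Schwarz[OF L2_diff[OF VL[OF fV] w] VL[OF v]] VL v w fV
        by (simp add: ip_diff_left)
      show "(\<lambda>n. nrm M (\<lambda>x. f n x - w x) * nrm M v) \<longlonglongrightarrow> 0"
        using tendsto_mult_left_zero[OF fw] .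
    qed
    then have ipl: "(\<lambda>n. ip M (f n) v) \<longlonglongrightarrow> ip M w v" by (simp add: LIM_zero_iff)
    \<comment> \<open>The limit \<open>w\<close> may lie outside \<open>V\<close>, so it cannot be
      inserted into \<open>F\<close>. The variation is taken at \<open>f n\<close>, with error
      \<open>inverse (Suc n)\<close>, and passed to the limit.\<close>
    have ge: "0 \<le> 2 * t * (ip M w v - l v) + t\<^sup>2 * ip M v v" for t
    proof (rule LIMSEQ_le_const)
      show "(\<lambda>n. inverse (real (Suc n)) + (2 * t * (ip M (f n) v - l v) + t\<^sup>2 * ip M v v))
          \<longlonglongrightarrow> 2 * t * (ip M w v - l v) + t\<^sup>2 * ip M v v"
        using LIMSEQ_inverse_real_of_nat
        by (rule tendsto_eq_rhs[OF tendsto_add]) (auto intro!: tendsto_intros ipl)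
      have "0 \<le> inverse (real (Suc n)) + (2 * t * (ip M (f n) v - l v) + t\<^sup>2 * ip M v v)" for n
        using m_le[OF Vadd[OF fV[of n] Vscale[OF v, of t]]] fm[of n] F_add[OF fV[of n] v, of t]
        by linarith
      then show "\<exists>N. \<forall>n\<ge>N. 0 \<le> inverse (real (Suc n)) + (2 * t * (ip M (f n) v - l v) + t\<^sup>2 * ip M v v)"
        by blast
    qed
    define d where "d = ip M w v - l v"
    have pos: "1 + ip M v v > 0" using ip_self_nonneg[of M v] by linarith
    \<comment> \<open>The minimiser of 2 t d + t^2 (1 + (v,v)); the added 1 keeps the divisor
      positive when \<open>v\<close> has norm zero.\<close>
    define t where "t = - d / (1 + ip M v v)"
    have "0 \<le> 2 * t * d + t\<^sup>2 * (1 + ip M v v)"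
      using ge[of t] zero_le_power2[of t] unfolding d_def[symmetric] distrib_left by linarith
    also have "\<dots> = t * (2 * d + t * (1 + ip M v v))"
      by (simp add: power2_eq_square algebra_simps)
    also have "t * (1 + ip M v v) = - d" using pos by (simp add: t_def)
    also have "t * (2 * d + - d) = - (d\<^sup>2 / (1 + ip M v v))"
      by (simp add: t_def power2_eq_square)
    finally have "d\<^sup>2 \<le> 0" using pos by (simp add: divide_le_0_iff)
    then show ?thesis by (simp add: d_def)
  qed
  with w show ?thesis by blast
qed

section \<open>Contraction semigroups, resolvents and forms\<close>

text \<open>Testing with v = u. Laplace transforms are known only through their scalar products, and
  this recovers a norm bound from them.\<close>

lemma nrm_le_of_ip_le:
  assumes u: "u \<in> L2 M" and le: "\<And>v. v \<in> L2 M \<Longrightarrow> \<bar>ip M u v\<bar> \<le> c * nrm M v" and "c \<ge> 0"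
  shows "nrm M u \<le> c"
proof (cases "nrm M u = 0")
  case False
  then have pos: "nrm M u > 0" by (simp add: less_le)
  have "nrm M u * nrm M u \<le> c * nrm M u"
    using le[OF u] ip_self_nonneg[of M u] by (simp flip: nrm_square power2_eq_square)
  then show ?thesis using pos by simp
qed (use assms in simp)

lemma eventually_at_right_0I: "(\<And>t::real. t > 0 \<Longrightarrow> P t) \<Longrightarrow> \<forall>\<^sub>F t in at_right 0. P t"
  by (rule eventually_mono[OF eventually_at_right_less])

section \<open>Contraction semigroups: continuity and adjoints\<close>

locale L2_contraction_semigroup = prob_space M for M :: "'a measure" +
  fixes T :: "real \<Rightarrow> ('a \<Rightarrow> real) \<Rightarrow> 'a \<Rightarrow> real"
  assumes contraction: "contraction_semigroup M T"
begin

lemma T_L2 [simp]: "t \<ge> 0 \<Longrightarrow> u \<in> L2 M \<Longrightarrow> T t u \<in> L2 M"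
  and T_cong: "t \<ge> 0 \<Longrightarrow> u \<in> L2 M \<Longrightarrow> v \<in> L2 M \<Longrightarrow> AE x in M. u x = v x \<Longrightarrow> AE x in M. T t u x = T t v x"
  and T_add: "t \<ge> 0 \<Longrightarrow> u \<in> L2 M \<Longrightarrow> v \<in> L2 M \<Longrightarrow> AE x in M. T t (\<lambda>y. u y + v y) x = T t u x + T t v x"
  and T_scale: "t \<ge> 0 \<Longrightarrow> u \<in> L2 M \<Longrightarrow> AE x in M. T t (\<lambda>y. c * u y) x = c * T t u x"
  using contraction
  by (simp_all add: contraction_semigroup_def strongly_continuous_semigroup_def linear_operator_L2_def)

lemma T_semigroup: "s \<ge> 0 \<Longrightarrow> t \<ge> 0 \<Longrightarrow> u \<in> L2 M \<Longrightarrow> AE x in M. T (s + t) u x = T s (T t u) x"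
  and T_cont: "u \<in> L2 M \<Longrightarrow> ((\<lambda>t. nrm M (\<lambda>x. T t u x - u x)) \<longlongrightarrow> 0) (at_right 0)"
  and T_nrm: "t \<ge> 0 \<Longrightarrow> u \<in> L2 M \<Longrightarrow> nrm M (T t u) \<le> nrm M u"
  using contraction
  by (simp_all add: contraction_semigroup_def strongly_continuous_semigroup_def)

lemma T_diff:
  assumes t: "t \<ge> 0" and u: "u \<in> L2 M" and v: "v \<in> L2 M"
  shows "AE x in M. T t (\<lambda>y. u y - v y) x = T t u x - T t v x"
  using T_add[OF t u L2_scale[OF v, of "-1"]] T_scale[OF t v, of "-1"]
  by eventually_elim simp

text \<open>The difference is \<open>T s\<close> applied to T(t-s) u - u, and \<open>T s\<close>
  contracts. The bound depends on t - s alone, so continuity from the right at 0 yields two-sided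
  continuity everywhere.\<close>

lemma nrm_T_diff_le:
  assumes s: "0 \<le> s" "s \<le> t" and u: "u \<in> L2 M"
  shows "nrm M (\<lambda>x. T t u x - T s u x) \<le> nrm M (\<lambda>x. T (t - s) u x - u x)"
proof -
  have "AE x in M. T t u x - T s u x = T s (\<lambda>x. T (t - s) u x - u x) x"
    using T_semigroup[OF s(1) _ u, of "t - s"] T_diff[OF s(1) T_L2[OF _ u, of "t - s"] u] s
    by auto
  then have "nrm M (\<lambda>x. T t u x - T s u x) = nrm M (T s (\<lambda>x. T (t - s) u x - u x))"
    using s u by (intro nrm_cong_AE L2_measurable) auto
  also have "\<dots> \<le> nrm M (\<lambda>x. T (t - s) u x - u x)"
    using s u by (intro T_nrm) auto
  finally show ?thesis .
qed

text \<open>Supplies the measurability in \<open>t\<close> of the integrand of the Laplace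
  transform.\<close>

lemma continuous_on_ip_T:
  assumes u: "u \<in> L2 M" and v: "v \<in> L2 M"
  shows "continuous_on {0..} (\<lambda>t. ip M (T t u) v)"
  unfolding continuous_on_iff
proof (intro ballI allI impI)
  fix t e :: real assume t: "t \<in> {0..}" and e: "e > 0"
  define e' where "e' = e / (1 + nrm M v)"
  have pos: "1 + nrm M v > 0" using nrm_nonneg[of M v] by linarith
  have e': "e' > 0" using e pos by (simp add: e'_def)
  have "\<forall>\<^sub>F h in at_right 0. nrm M (\<lambda>x. T h u x - u x) < e'"
    using T_cont[OF u] e' by (rule order_tendstoD)
  then obtain d where d: "d > 0" "\<And>h. 0 < h \<Longrightarrow> h < d \<Longrightarrow> nrm M (\<lambda>x. T h u x - u x) < e'"
    unfolding eventually_at_right_field by auto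
  have *: "\<bar>ip M (T s' u) v - ip M (T s u) v\<bar> < e" if "0 \<le> s" "s < s'" "s' - s < d" for s s'
  proof -
    have "\<bar>ip M (T s' u) v - ip M (T s u) v\<bar> = \<bar>ip M (\<lambda>x. T s' u x - T s u x) v\<bar>"
      using that u v by (simp add: ip_diff_left)
    also have "\<dots> \<le> nrm M (\<lambda>x. T s' u x - T s u x) * nrm M v"
      using that u v by (intro ip_Cauchy_Schwarz) auto
    also have "\<dots> \<le> nrm M (\<lambda>x. T (s' - s) u x - u x) * nrm M v"
      using that u by (intro mult_right_mono nrm_T_diff_le) auto
    also have "\<dots> \<le> e' * nrm M v"
      using d(2)[of "s' - s"] that by (intro mult_right_mono) auto
    also have "\<dots> < e' * (1 + nrm M v)" using e' by simp
    also have "\<dots> = e" using pos by (simp add: e'_def)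
    finally show ?thesis .
  qed
  have "dist (ip M (T s u) v) (ip M (T t u) v) < e" if "s \<in> {0..}" "dist s t < d" for s
    using that t e *[of s t] *[of t s]
    by (cases s t rule: linorder_cases) (auto simp: dist_real_def abs_minus_commute)
  then show "\<exists>d>0. \<forall>x'\<in>{0..}. dist x' t < d \<longrightarrow> dist (ip M (T x' u) v) (ip M (T t u) v) < e"
    using d(1) by blast
qed

text \<open>Lets \<open>T h\<close> be moved past the Laplace integral, which is defined only
  through pairings: \<open>T h u\<close> against \<open>v\<close> becomes \<open>u\<close> against
  \<open>v'\<close>.\<close>

lemma adjoint:
  assumes h: "h \<ge> 0" and v: "v \<in> L2 M"
  obtains v' where "v' \<in> L2 M" "\<And>w. w \<in> L2 M \<Longrightarrow> ip M (T h w) v = ip M w v'"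
proof -
  have "\<exists>v'\<in>L2 M. \<forall>w\<in>L2 M. ip M (T h w) v = ip M v' w"
  proof (rule L2_Riesz[where K = "nrm M v"])
    show "ip M (T h (\<lambda>x. a x + b x)) v = ip M (T h a) v + ip M (T h b) v"
      if "a \<in> L2 M" "b \<in> L2 M" for a b
    proof -
      have "ip M (T h (\<lambda>x. a x + b x)) v = ip M (\<lambda>x. T h a x + T h b x) v"
        using that h v by (intro ip_cong_AE T_add L2_measurable) auto
      then show ?thesis using that h v by (simp add: ip_add_left)
    qed
    show "ip M (T h (\<lambda>x. c * a x)) v = c * ip M (T h a) v" if "a \<in> L2 M" for a c
    proof -
      have "ip M (T h (\<lambda>x. c * a x)) v = ip M (\<lambda>x. c * T h a x) v"
        using that h v by (intro ip_cong_AE T_scale L2_measurable) auto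
      then show ?thesis by (simp add: ip_scale_left)
    qed
    show "\<bar>ip M (T h a) v\<bar> \<le> nrm M v * nrm M a" if "a \<in> L2 M" for a
      using order_trans[OF ip_Cauchy_Schwarz[of "T h a" M v] mult_right_mono[OF T_nrm]] that h v
      by (simp add: mult.commute)
  qed auto
  then show ?thesis using that by (metis ip_commute)
qed

section \<open>The resolvent as a Laplace transform\<close>

text \<open>The solution of \<open>(b - A) u = g\<close> is the Laplace transform of \<open>t \<mapsto> T t g\<close>. Its scalar products
  with \<open>v\<close> are integrals of real functions, so that no integral of \<open>L\<^sup>2\<close>-valued functions is needed.\<close>

lemma Laplace_transform:
  assumes g: "g \<in> L2 M" and b: "b > 0"
  obtains u where "u \<in> L2 M"
    and "\<And>v. v \<in> L2 M \<Longrightarrow> set_integrable lborel {0<..} (\<lambda>t. exp (- (t * b)) * ip M (T t g) v)"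
    and "\<And>v. v \<in> L2 M \<Longrightarrow> ip M u v = (LBINT t:{0<..}. exp (- (t * b)) * ip M (T t g) v)"
proof -
  have bound: "\<bar>indicator {0<..} t * (exp (- (t * b)) * ip M (T t g) v)\<bar>
      \<le> indicator {0<..} t * exp (- (t * b)) * (nrm M g * nrm M v)" if "v \<in> L2 M" for v t
  proof (cases "t > 0")
    case True
    then have "\<bar>ip M (T t g) v\<bar> \<le> nrm M g * nrm M v"
      using order_trans[OF ip_Cauchy_Schwarz[of "T t g" M v] mult_right_mono[OF T_nrm]] that g
      by simp
    then show ?thesis using True by (simp add: abs_mult mult_left_mono)
  qed simp
  have intE: "integrable lborel (\<lambda>t. indicator {0<..} t * exp (- (t * b)))"
    using integrable_I0i_exp_mscale[OF b] by (simp add: set_integrable_def)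
  have int: "integrable lborel (\<lambda>t. indicator {0<..} t * (exp (- (t * b)) * ip M (T t g) v))"
    if v: "v \<in> L2 M" for v
  proof (rule Bochner_Integration.integrable_bound)
    show "integrable lborel (\<lambda>t. indicator {0<..} t * exp (- (t * b)) * (nrm M g * nrm M v))"
      using intE by (rule integrable_mult_left)
    have "continuous_on {0<..} (\<lambda>t. exp (- (t * b)) * ip M (T t g) v)"
      by (intro continuous_intros continuous_on_subset[OF continuous_on_ip_T[OF g v]]) auto
    from borel_measurable_continuous_on_indicator[OF _ this]
    show "(\<lambda>t. indicator {0<..} t * (exp (- (t * b)) * ip M (T t g) v)) \<in> borel_measurable lborel"
      by simp
    show "AE t in lborel. norm (indicator {0<..} t * (exp (- (t * b)) * ip M (T t g) v))
        \<le> norm (indicator {0<..} t * exp (- (t * b)) * (nrm M g * nrm M v))"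
      using bound[OF v] by (auto intro!: AE_I2 intro: order_trans[OF _ abs_ge_self])
  qed
  define l where "l v = (LINT t|lborel. indicator {0<..} t * (exp (- (t * b)) * ip M (T t g) v))" for v
  have "\<exists>u\<in>L2 M. \<forall>v\<in>L2 M. l v = ip M u v"
  proof (rule L2_Riesz[where K = "(LINT t|lborel. indicator {0<..} t * exp (- (t * b))) * nrm M g"])
    show "l (\<lambda>x. v x + w x) = l v + l w" if "v \<in> L2 M" "w \<in> L2 M" for v w
    proof -
      have "l (\<lambda>x. v x + w x) = (LINT t|lborel. indicator {0<..} t * (exp (- (t * b)) * ip M (T t g) v)
          + indicator {0<..} t * (exp (- (t * b)) * ip M (T t g) w))"
        unfolding l_def using that g
        by (intro Bochner_Integration.integral_cong) (auto simp: indicator_def ip_add_right distrib_left)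
      then show ?thesis using int that by (simp add: l_def)
    qed
    show "l (\<lambda>x. c * v x) = c * l v" for v c
    proof -
      have "l (\<lambda>x. c * v x) = (LINT t|lborel. c * (indicator {0<..} t * (exp (- (t * b)) * ip M (T t g) v)))"
        unfolding l_def by (simp add: ip_scale_right mult_ac)
      then show ?thesis by (simp add: l_def)
    qed
    show "\<bar>l v\<bar> \<le> (LINT t|lborel. indicator {0<..} t * exp (- (t * b))) * nrm M g * nrm M v"
      if v: "v \<in> L2 M" for v
    proof -
      have "\<bar>l v\<bar> \<le> (LINT t|lborel. indicator {0<..} t * exp (- (t * b)) * (nrm M g * nrm M v))"
        unfolding l_def using int[OF v] bound[OF v] intE
        by (intro integral_abs_bound_integral) auto
      then show ?thesis by (simp only: integral_mult_left_zero mult.assoc[of _ "nrm M g"])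
    qed
  qed auto
  then show ?thesis
    using that int by (auto simp: l_def set_integrable_def set_lebesgue_integral_def)
qed

text \<open>Shifting the Laplace integral by h shows that u - exp(-hb) T(h) u is the integral of
  exp(-sb) T(s) g over (0,h]. Divided by h this tends to g, so u has the derivative b u - g.\<close>

lemma strong_derivative_Laplace:
  assumes g: "g \<in> L2 M" and b: "b > 0"
  obtains u where "u \<in> L2 M" "strong_derivative_at_0 M T u (\<lambda>x. b * u x - g x)"
proof -
  obtain u where u: "u \<in> L2 M"
    and int: "\<And>v. v \<in> L2 M \<Longrightarrow> set_integrable lborel {0<..} (\<lambda>t. exp (- (t * b)) * ip M (T t g) v)"
    and ip_u: "\<And>v. v \<in> L2 M \<Longrightarrow> ip M u v = (LBINT t:{0<..}. exp (- (t * b)) * ip M (T t g) v)"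
    using Laplace_transform[OF g b] by blast
  have shift: "ip M u v - exp (- (h * b)) * ip M (T h u) v
      = (LBINT s:{0<..h}. exp (- (s * b)) * ip M (T s g) v)"
    if h: "h > 0" and v: "v \<in> L2 M" for h v
  proof -
    let ?q = "\<lambda>s. exp (- (s * b)) * ip M (T s g) v"
    \<comment> \<open>With the adjoint, the formula for \<open>u\<close> is used with
      \<open>v'\<close> in place of \<open>v\<close>; the semigroup law and the substitution s = h +
      t then move the integral to (h, infinity).\<close>
    obtain v' where v': "v' \<in> L2 M" "\<And>w. w \<in> L2 M \<Longrightarrow> ip M (T h w) v = ip M w v'"
      using adjoint[OF less_imp_le[OF h] v] by blast
    have "ip M (T h u) v = (LBINT t:{0<..}. exp (- (t * b)) * ip M (T t g) v')"
      using v' u ip_u by simp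
    also have "\<dots> = (LBINT t:{0<..}. exp (h * b) * ?q (h + t))"
    proof (rule set_lebesgue_integral_cong)
      show "\<forall>t. t \<in> {0<..} \<longrightarrow> exp (- (t * b)) * ip M (T t g) v' = exp (h * b) * ?q (h + t)"
      proof (intro allI impI)
        fix t :: real assume "t \<in> {0<..}"
        then have t: "t > 0" by simp
        have "ip M (T t g) v' = ip M (T h (T t g)) v"
          using v' t g by simp
        also have "\<dots> = ip M (T (h + t) g) v"
          using T_semigroup[of h t g] t h g v by (intro ip_cong_AE L2_measurable) auto
        finally show "exp (- (t * b)) * ip M (T t g) v' = exp (h * b) * ?q (h + t)"
          by (simp add: algebra_simps flip: exp_add)
      qed
    qed simp
    also have "\<dots> = exp (h * b) * (LBINT t:{0<..}. ?q (h + t))" by simp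
    also have "(LBINT t:{0<..}. ?q (h + t)) = (LBINT s:{h<..}. ?q s)"
      unfolding set_lebesgue_integral_def
      by (subst (2) lborel_integral_real_affine[where c = 1 and t = h]) (auto simp: indicator_def)
    finally have e: "exp (- (h * b)) * ip M (T h u) v = (LBINT s:{h<..}. ?q s)"
      by (simp flip: exp_add)
    have "{0<..} = {0<..h} \<union> {h<..}" using h by auto
    then have "ip M u v = (LBINT s:{0<..h} \<union> {h<..}. ?q s)"
      using ip_u[OF v] by simp
    also have "\<dots> = (LBINT s:{0<..h}. ?q s) + (LBINT s:{h<..}. ?q s)"
      using h by (intro set_integral_Un) (auto intro!: set_integrable_subset[OF int[OF v]])
    finally show ?thesis using e by simp
  qed
  \<comment> \<open>By \<open>shift\<close>, \<open>E h\<close> is the mean over (0,h] of exp(-sb)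
    T(s) g, minus g, in the weak sense.\<close>
  define E where "E h x = (u x - exp (- (h * b)) * T h u x) / h - g x" for h x
  have E_L2: "E h \<in> L2 M" if "h > 0" for h
    unfolding E_def using u g that by simp
  have lim_E: "((\<lambda>h. nrm M (E h)) \<longlongrightarrow> 0) (at_right 0)"
  proof (rule tendstoI)
    fix e :: real assume e: "e > 0"
    have "((\<lambda>s. (1 - exp (- (s * b))) * nrm M g + nrm M (\<lambda>x. T s g x - g x)) \<longlongrightarrow>
        (1 - exp (- (0 * b))) * nrm M g + 0) (at_right 0)"
      by (intro tendsto_intros T_cont g)
    then have "\<forall>\<^sub>F s in at_right 0. (1 - exp (- (s * b))) * nrm M g + nrm M (\<lambda>x. T s g x - g x) < e / 2"
      using e by (intro order_tendstoD(2)) auto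
    then obtain d where d: "d > 0" "\<And>s. 0 < s \<Longrightarrow> s < d \<Longrightarrow>
        (1 - exp (- (s * b))) * nrm M g + nrm M (\<lambda>x. T s g x - g x) < e / 2"
      unfolding eventually_at_right_field by auto
    have "nrm M (E h) \<le> e / 2" if h: "0 < h" "h < d" for h
    proof (rule nrm_le_of_ip_le[OF E_L2[OF h(1)]])
      fix v assume v: "v \<in> L2 M"
      let ?q = "\<lambda>s. exp (- (s * b)) * ip M (T s g) v"
      have i1: "set_integrable lborel {0<..h} ?q"
        by (rule set_integrable_subset[OF int[OF v]]) auto
      have i2: "set_integrable lborel {0<..h} (\<lambda>s. c :: real)" for c
        unfolding set_integrable_def
        by (simp add: integrable_indicator_iff emeasure_lborel_Ioc[OF less_imp_le[OF h(1)]])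
      have meas: "(LBINT s:{0<..h}. c) = c * h" for c :: real
        using h by (simp add: set_lebesgue_integral_def)
      have "ip M (E h) v = (ip M u v - exp (- (h * b)) * ip M (T h u) v) / h - ip M g v"
        unfolding E_def using u g v h by (simp add: ip_linear ip_divide_left)
      also have "\<dots> = ((LBINT s:{0<..h}. ?q s) - (LBINT s:{0<..h}. ip M g v)) / h"
        using h by (simp add: shift[OF h(1) v] meas diff_divide_distrib)
      also have "\<dots> = (LBINT s:{0<..h}. ?q s - ip M g v) / h"
        using i1 i2 by (simp add: set_integral_diff)
      finally have eq: "\<bar>ip M (E h) v\<bar> = \<bar>LBINT s:{0<..h}. ?q s - ip M g v\<bar> / h"
        using h by simp
      \<comment> \<open>The bound is proportional to \<open>nrm M v\<close>, uniformly in
        \<open>v\<close>, so the weak estimate becomes one for \<open>nrm M (E h)\<close>.\<close>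
      have pt: "\<bar>?q s - ip M g v\<bar> \<le> e / 2 * nrm M v" if s: "0 < s" "s \<le> h" for s
      proof -
        have "?q s - ip M g v = exp (- (s * b)) * ip M (\<lambda>x. T s g x - g x) v - (1 - exp (- (s * b))) * ip M g v"
          using s g v by (simp add: ip_diff_left algebra_simps)
        also have "\<bar>\<dots>\<bar> \<le> 1 * (nrm M (\<lambda>x. T s g x - g x) * nrm M v)
            + (1 - exp (- (s * b))) * (nrm M g * nrm M v)"
        proof (intro order_trans[OF abs_triangle_ineq4] add_mono)
          show "\<bar>exp (- (s * b)) * ip M (\<lambda>x. T s g x - g x) v\<bar> \<le> 1 * (nrm M (\<lambda>x. T s g x - g x) * nrm M v)"
            unfolding abs_mult using s b g v by (intro mult_mono ip_Cauchy_Schwarz) auto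
          show "\<bar>(1 - exp (- (s * b))) * ip M g v\<bar> \<le> (1 - exp (- (s * b))) * (nrm M g * nrm M v)"
            unfolding abs_mult using s b g v by (intro mult_mono ip_Cauchy_Schwarz) auto
        qed
        also have "\<dots> = ((1 - exp (- (s * b))) * nrm M g + nrm M (\<lambda>x. T s g x - g x)) * nrm M v"
          by (simp add: algebra_simps)
        also have "\<dots> \<le> e / 2 * nrm M v"
          using d(2)[of s] s h by (intro mult_right_mono) auto
        finally show ?thesis .
      qed
      have "\<bar>LBINT s:{0<..h}. ?q s - ip M g v\<bar> \<le> (LBINT s:{0<..h}. e / 2 * nrm M v)"
        unfolding set_lebesgue_integral_def
      proof (rule integral_abs_bound_integral)
        show "integrable lborel (\<lambda>s. indicator {0<..h} s *\<^sub>R (?q s - ip M g v))"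
          using set_integral_diff(1)[OF i1 i2] by (simp add: set_integrable_def)
        show "integrable lborel (\<lambda>s. indicator {0<..h} s *\<^sub>R (e / 2 * nrm M v))"
          using i2 by (simp add: set_integrable_def)
      qed (use pt in \<open>auto simp: indicator_def\<close>)
      then show "\<bar>ip M (E h) v\<bar> \<le> e / 2 * nrm M v"
        using h unfolding eq meas by (simp add: divide_le_eq)
    qed (use e in simp)
    then have "\<forall>h. 0 < h \<longrightarrow> h < d \<longrightarrow> dist (nrm M (E h)) 0 < e"
      using e by (simp add: dist_real_def) (smt (verit))
    then show "\<forall>\<^sub>F h in at_right 0. dist (nrm M (E h)) 0 < e"
      using d(1) unfolding eventually_at_right_field by auto
  qed
  have "((\<lambda>h. nrm M (\<lambda>x. (T h u x - u x) / h - (b * u x - g x))) \<longlongrightarrow> 0) (at_right 0)"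
  proof (rule tendsto_sandwich[where f = "\<lambda>_. 0"])
    let ?R = "\<lambda>h. exp (h * b) * nrm M (E h) + (\<bar>(exp (h * b) - 1) / h - b\<bar> * nrm M u + \<bar>1 - exp (h * b)\<bar> * nrm M g)"
    have "nrm M (\<lambda>x. (T h u x - u x) / h - (b * u x - g x)) \<le> ?R h" if h: "h > 0" for h
    proof -
      \<comment> \<open>Solves the definition of \<open>E h\<close> for \<open>T h u\<close>. Of the
        two remaining coefficients, the one of \<open>u\<close> tends to 0 because b is the
        derivative of exp(hb) at h = 0, the one of \<open>g\<close> by continuity.\<close>
      have "(T h u x - u x) / h - (b * u x - g x) = (- exp (h * b)) * E h x
          + (((exp (h * b) - 1) / h - b) * u x + (1 - exp (h * b)) * g x)" for x
      proof -
        have "exp (h * b) * exp (- (h * b)) = (1::real)" by (simp flip: exp_add)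
        then have "exp (h * b) * (exp (- (h * b)) * T h u x) = T h u x"
          by (simp flip: mult.assoc)
        then show ?thesis using h by (simp add: E_def field_simps)
      qed
      then have "nrm M (\<lambda>x. (T h u x - u x) / h - (b * u x - g x))
        = nrm M (\<lambda>x. (- exp (h * b)) * E h x + (((exp (h * b) - 1) / h - b) * u x + (1 - exp (h * b)) * g x))"
        by presburger
      also have "\<dots> \<le> nrm M (\<lambda>x. (- exp (h * b)) * E h x)
          + (nrm M (\<lambda>x. ((exp (h * b) - 1) / h - b) * u x) + nrm M (\<lambda>x. (1 - exp (h * b)) * g x))"
        using E_L2[OF h] u g
        by (intro order_trans[OF nrm_triangle] add_left_mono nrm_triangle L2_add L2_scale)
      also have "\<dots> = ?R h" unfolding nrm_scale by simp
      finally show ?thesis .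
    qed
    then show "\<forall>\<^sub>F h in at_right 0. nrm M (\<lambda>x. (T h u x - u x) / h - (b * u x - g x)) \<le> ?R h"
      by (rule eventually_at_right_0I)
    have "((\<lambda>h. (exp (h * b) - 1) / h) \<longlongrightarrow> b) (at 0)"
    proof -
      have "((\<lambda>h. exp (h * b)) has_field_derivative b) (at 0)"
        by (auto intro!: derivative_eq_intros)
      then show ?thesis by (simp add: has_field_derivative_iff)
    qed
    then have "((\<lambda>h. (exp (h * b) - 1) / h) \<longlongrightarrow> b) (at_right 0)"
      by (rule tendsto_within_subset) simp
    then have "(?R \<longlongrightarrow> exp (0 * b) * 0 + (\<bar>b - b\<bar> * nrm M u + \<bar>1 - exp (0 * b)\<bar> * nrm M g)) (at_right 0)"
      by (intro tendsto_intros lim_E)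
    then show "(?R \<longlongrightarrow> 0) (at_right 0)" by simp
  qed auto
  then show ?thesis
    using that[OF u] u g by (simp add: strong_derivative_at_0_def)
qed

text \<open>Needed to change representatives: \<open>gen\<close> and \<open>resolvent\<close> are
  choices, whereas the elements of \<open>C\<close> agree with resolvents only almost
  everywhere.\<close>

lemma strong_derivative_cong:
  assumes "strong_derivative_at_0 M T u w" "u \<in> L2 M" "u' \<in> L2 M" "AE x in M. u x = u' x"
    and "w' \<in> L2 M" "AE x in M. w x = w' x"
  shows "strong_derivative_at_0 M T u' w'"
  unfolding strong_derivative_at_0_def
proof
  have w: "w \<in> L2 M" and lim: "((\<lambda>t. nrm M (\<lambda>x. (T t u x - u x) / t - w x)) \<longlongrightarrow> 0) (at_right 0)"
    using assms(1) by (auto simp: strong_derivative_at_0_def)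
  have "nrm M (\<lambda>x. (T t u x - u x) / t - w x) = nrm M (\<lambda>x. (T t u' x - u' x) / t - w' x)" if "t > 0" for t
  proof (rule nrm_cong_AE)
    show "AE x in M. (T t u x - u x) / t - w x = (T t u' x - u' x) / t - w' x"
      using T_cong[OF less_imp_le[OF that] assms(2-4)] assms(4,6) by eventually_elim simp
  qed (use that assms w in \<open>auto intro!: L2_measurable\<close>)
  then show "((\<lambda>t. nrm M (\<lambda>x. (T t u' x - u' x) / t - w' x)) \<longlongrightarrow> 0) (at_right 0)"
    by (intro Lim_transform_eventually[OF lim]) (rule eventually_at_right_0I, simp)
qed (fact assms)

lemma strong_derivative_unique:
  assumes u: "u \<in> L2 M" and w: "strong_derivative_at_0 M T u w" "strong_derivative_at_0 M T u w'"
  shows "AE x in M. w x = w' x"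
proof -
  have L: "w \<in> L2 M" "w' \<in> L2 M"
    using w by (auto simp: strong_derivative_at_0_def)
  let ?n = "\<lambda>w t. nrm M (\<lambda>x. (T t u x - u x) / t - w x)"
  have le: "nrm M (\<lambda>x. w x - w' x) \<le> ?n w t + ?n w' t" if "t > 0" for t
    using nrm_triangle_diff[of w M "\<lambda>x. (T t u x - u x) / t" w'] L u that
    by (simp add: nrm_diff_commute[of M w])
  have lim: "((\<lambda>t. ?n w t + ?n w' t) \<longlongrightarrow> 0 + 0) (at_right 0)"
    using w by (intro tendsto_add) (auto simp: strong_derivative_at_0_def)
  have "nrm M (\<lambda>x. w x - w' x) \<le> 0 + 0"
    by (rule tendsto_lowerbound[OF lim eventually_at_right_0I[OF le]]) simp_all
  then show ?thesis
    using L by (intro nrm_diff_eq_0_AE) (simp_all add: antisym)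
qed

text \<open>The Laplace transform is a witness for the choice in \<open>resolvent\<close>, and
  uniqueness of derivatives identifies \<open>gen\<close>. All later facts about resolvents come
  from here, free of \<open>gen\<close>.\<close>

lemma resolvent_spec:
  assumes g: "g \<in> L2 M" and b: "b > 0"
  shows "resolvent M T b g \<in> L2 M"
    and "strong_derivative_at_0 M T (resolvent M T b g) (\<lambda>x. b * resolvent M T b g x - g x)"
proof -
  have gen: "strong_derivative_at_0 M T u (gen M T u)" if "u \<in> gen_dom M T" for u
    using that unfolding gen_def by (intro someI_ex[of "strong_derivative_at_0 M T u"]) (simp add: gen_dom_def)
  obtain u where u: "u \<in> L2 M" "strong_derivative_at_0 M T u (\<lambda>x. b * u x - g x)"
    using strong_derivative_Laplace[OF g b] by blast
  then have ud: "u \<in> gen_dom M T" by (auto simp: gen_dom_def)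
  have "AE x in M. b * u x - gen M T u x = g x"
    using strong_derivative_unique[OF u(1) gen[OF ud] u(2)] by eventually_elim simp
  with ud have "resolvent M T b g \<in> gen_dom M T \<and>
      (AE x in M. b * resolvent M T b g x - gen M T (resolvent M T b g) x = g x)"
    unfolding resolvent_def by - (rule someI[where x = u], rule conjI)
  then have rd: "resolvent M T b g \<in> gen_dom M T"
    and ae: "AE x in M. b * resolvent M T b g x - gen M T (resolvent M T b g) x = g x" by auto
  show L: "resolvent M T b g \<in> L2 M" using rd by (simp add: gen_dom_def)
  show "strong_derivative_at_0 M T (resolvent M T b g) (\<lambda>x. b * resolvent M T b g x - g x)"
    using ae by (intro strong_derivative_cong[OF gen[OF rd] L L]) (auto simp: L g elim: eventually_mono)
qed

section \<open>Forms: values at derivatives, bilinearity, positivity\<close>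

lemma form_dom_tendsto:
  "u \<in> form_dom M T \<Longrightarrow> v \<in> L2 M \<Longrightarrow>
    ((\<lambda>t. ip M (\<lambda>x. (u x - T t u x) / t) v) \<longlongrightarrow> real_of_ereal (form M T u v)) (at_right 0)"
  by (auto simp: form_dom_def form_def tendsto_Lim)

lemma form_real: "u \<in> form_dom M T \<Longrightarrow> form M T u v = ereal (real_of_ereal (form M T u v))"
  by (simp add: form_def)

lemma form_eqI:
  assumes "u \<in> form_dom M T" "((\<lambda>t. ip M (\<lambda>x. (u x - T t u x) / t) v) \<longlongrightarrow> l) (at_right 0)"
  shows "form M T u v = ereal l"
  using assms by (simp add: form_def tendsto_Lim)

text \<open>A strong derivative is a weak one, by Cauchy-Schwarz; the sign appears because the form
  uses u - T(t) u.\<close>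

lemma strong_derivative_tendsto:
  assumes u: "u \<in> L2 M" and w: "strong_derivative_at_0 M T u w" and v: "v \<in> L2 M"
  shows "((\<lambda>t. ip M (\<lambda>x. (u x - T t u x) / t) v) \<longlongrightarrow> - ip M w v) (at_right 0)"
proof -
  have wL: "w \<in> L2 M" and lim: "((\<lambda>t. nrm M (\<lambda>x. (T t u x - u x) / t - w x)) \<longlongrightarrow> 0) (at_right 0)"
    using w by (auto simp: strong_derivative_at_0_def)
  have "norm (ip M (\<lambda>x. (u x - T t u x) / t) v - - ip M w v)
      \<le> nrm M (\<lambda>x. (T t u x - u x) / t - w x) * nrm M v" if "t > 0" for t
  proof -
    have "ip M (\<lambda>x. (u x - T t u x) / t) v - - ip M w v = - ip M (\<lambda>x. (T t u x - u x) / t - w x) v"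
      using that u wL v by (simp add: ip_linear ip_divide_left field_simps)
    then show ?thesis
      using ip_Cauchy_Schwarz[of "\<lambda>x. (T t u x - u x) / t - w x" M v] that u wL v by simp
  qed
  then have "((\<lambda>t. ip M (\<lambda>x. (u x - T t u x) / t) v - - ip M w v) \<longlongrightarrow> 0) (at_right 0)"
    by (intro Lim_null_comparison[OF _ tendsto_mult_left_zero[OF lim, of "nrm M v"]]
        eventually_at_right_0I) auto
  then show ?thesis by (simp only: LIM_zero_iff)
qed

lemma strong_derivative_form_dom:
  "u \<in> L2 M \<Longrightarrow> strong_derivative_at_0 M T u w \<Longrightarrow> u \<in> form_dom M T"
  using strong_derivative_tendsto by (fastforce simp: form_dom_def)

lemma strong_derivative_form:
  "u \<in> L2 M \<Longrightarrow> strong_derivative_at_0 M T u w \<Longrightarrow> v \<in> L2 M \<Longrightarrow> form M T u v = ereal (- ip M w v)"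
  by (intro form_eqI strong_derivative_form_dom strong_derivative_tendsto)

text \<open>\<open>T t\<close> is linear only almost everywhere, so the quotients are matched inside
  \<open>ip\<close>. The coefficient \<open>c\<close> covers differences (c = -1) as well as the
  line u + s \<eta>.\<close>

lemma form_combination_tendsto:
  assumes u: "u \<in> form_dom M T" and u': "u' \<in> form_dom M T" and v: "v \<in> L2 M"
  shows "((\<lambda>t. ip M (\<lambda>x. ((u x + c * u' x) - T t (\<lambda>x. u x + c * u' x) x) / t) v) \<longlongrightarrow>
    real_of_ereal (form M T u v) + c * real_of_ereal (form M T u' v)) (at_right 0)"
proof -
  have L: "u \<in> L2 M" "u' \<in> L2 M" using u u' by (auto simp: form_dom_def)
  have "ip M (\<lambda>x. (u x - T t u x) / t) v + c * ip M (\<lambda>x. (u' x - T t u' x) / t) v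
      = ip M (\<lambda>x. ((u x + c * u' x) - T t (\<lambda>x. u x + c * u' x) x) / t) v" if t: "t > 0" for t
  proof -
    have "ip M (\<lambda>x. ((u x + c * u' x) - T t (\<lambda>x. u x + c * u' x) x) / t) v
      = ip M (\<lambda>x. (u x - T t u x) / t + c * ((u' x - T t u' x) / t)) v"
    proof (rule ip_cong_AE)
      show "AE x in M. ((u x + c * u' x) - T t (\<lambda>x. u x + c * u' x) x) / t
          = (u x - T t u x) / t + c * ((u' x - T t u' x) / t)"
        using T_add[of t u "\<lambda>x. c * u' x"] T_scale[of t u' c] t L
        by (auto simp: add_divide_distrib diff_divide_distrib algebra_simps)
    qed (use t L v in \<open>auto intro!: L2_measurable\<close>)
    also have "\<dots> = ip M (\<lambda>x. (u x - T t u x) / t) v + ip M (\<lambda>x. c * ((u' x - T t u' x) / t)) v"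
      using t L v by (intro ip_add_left L2_scale L2_divide L2_diff T_L2) auto
    finally show ?thesis unfolding ip_scale_left by simp
  qed
  then show ?thesis
    by (intro Lim_transform_eventually[OF tendsto_add[OF form_dom_tendsto[OF u v]
            tendsto_mult_left[OF form_dom_tendsto[OF u' v]]]]
        eventually_at_right_0I) auto
qed

lemma form_dom_combination:
  "u \<in> form_dom M T \<Longrightarrow> u' \<in> form_dom M T \<Longrightarrow> (\<lambda>x. u x + c * u' x) \<in> form_dom M T"
  using form_combination_tendsto[of u u'] by (fastforce simp: form_dom_def)

lemma form_combination_left:
  assumes "u \<in> form_dom M T" "u' \<in> form_dom M T" "v \<in> L2 M"
  shows "form M T (\<lambda>x. u x + c * u' x) v
    = ereal (real_of_ereal (form M T u v) + c * real_of_ereal (form M T u' v))"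
  using assms by (intro form_eqI form_dom_combination form_combination_tendsto)

lemma form_combination_right:
  assumes u: "u \<in> form_dom M T" and v: "v \<in> L2 M" "v' \<in> L2 M"
  shows "form M T u (\<lambda>x. v x + c * v' x)
    = ereal (real_of_ereal (form M T u v) + c * real_of_ereal (form M T u v'))"
proof (rule form_eqI[OF u])
  have L: "u \<in> L2 M" using u by (auto simp: form_dom_def)
  show "((\<lambda>t. ip M (\<lambda>x. (u x - T t u x) / t) (\<lambda>x. v x + c * v' x)) \<longlongrightarrow>
      real_of_ereal (form M T u v) + c * real_of_ereal (form M T u v')) (at_right 0)"
    using L v by (intro Lim_transform_eventually[OF tendsto_add[OF form_dom_tendsto[OF u v(1)]
            tendsto_mult_left[OF form_dom_tendsto[OF u v(2)]]]]
        eventually_at_right_0I) (auto simp: ip_add_right ip_scale_right)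
qed

text \<open>Used to exchange the chosen resolvent in (iii) for its representative in
  \<open>C\<close>.\<close>

lemma form_cong_right:
  assumes u: "u \<in> form_dom M T" and v: "v \<in> L2 M" "v' \<in> L2 M" "AE x in M. v x = v' x"
  shows "form M T u v = form M T u v'"
proof -
  have L: "u \<in> L2 M" using u by (auto simp: form_dom_def)
  have "form M T u v = ereal (real_of_ereal (form M T u v'))"
  proof (rule form_eqI[OF u Lim_transform_eventually[OF form_dom_tendsto[OF u v(2)]]])
    show "\<forall>\<^sub>F t in at_right 0. ip M (\<lambda>x. (u x - T t u x) / t) v' = ip M (\<lambda>x. (u x - T t u x) / t) v"
      using v L by (intro eventually_at_right_0I)
        (auto simp: ip_commute[of M "\<lambda>x. (u x - T _ u x) / _"] intro!: ip_cong_AE L2_measurable elim: eventually_mono)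
  qed
  then show ?thesis using form_real[OF u] by metis
qed

text \<open>By contractivity (T(t) u, u) is at most (u, u), so every quotient is
  nonnegative.\<close>

lemma form_nonneg:
  assumes u: "u \<in> form_dom M T"
  shows "0 \<le> real_of_ereal (form M T u u)"
proof -
  have L: "u \<in> L2 M" using u by (auto simp: form_dom_def)
  have "0 \<le> ip M (\<lambda>x. (u x - T t u x) / t) u" if t: "t > 0" for t
  proof -
    have "ip M (T t u) u \<le> nrm M (T t u) * nrm M u"
      using ip_Cauchy_Schwarz[of "T t u" M u] t L by simp
    also have "\<dots> \<le> nrm M u * nrm M u"
      using t L by (intro mult_right_mono T_nrm) auto
    also have "\<dots> = ip M u u" by (simp flip: nrm_square power2_eq_square)
    finally show ?thesis using t L by (simp add: ip_divide_left ip_diff_left)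
  qed
  then show ?thesis
    by (intro tendsto_lowerbound[OF form_dom_tendsto[OF u L] eventually_at_right_0I]) simp_all
qed

end

section \<open>Density and weak compactness\<close>

lemma L2_dominated:
  assumes "w \<in> L2 M" "u \<in> borel_measurable M" "\<And>x. x \<in> space M \<Longrightarrow> \<bar>u x\<bar> \<le> \<bar>w x\<bar>"
  shows "u \<in> L2 M"
proof -
  have "integrable M (\<lambda>x. (u x)\<^sup>2)"
    using assms(2,3) by (intro Bochner_Integration.integrable_bound[OF L2_integrable_square[OF assms(1)]])
      (auto simp: abs_le_square_iff)
  then show ?thesis using assms(2) by (simp add: L2_def)
qed

lemma L2_dominated_convergence:
  assumes w: "w \<in> L2 M" and U: "\<And>i. U i \<in> borel_measurable M" and u: "u \<in> borel_measurable M"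
    and lim: "\<And>x. x \<in> space M \<Longrightarrow> (\<lambda>i. U i x) \<longlonglongrightarrow> u x"
    and bound: "\<And>i x. x \<in> space M \<Longrightarrow> \<bar>u x - U i x\<bar> \<le> \<bar>w x\<bar>"
  shows "(\<lambda>i. nrm M (\<lambda>x. u x - U i x)) \<longlonglongrightarrow> 0"
proof -
  have "(\<lambda>i. \<integral>x. (u x - U i x)\<^sup>2 \<partial>M) \<longlonglongrightarrow> (\<integral>x. 0 \<partial>M)"
  proof (rule integral_dominated_convergence[OF _ _ L2_integrable_square[OF w]])
    show "AE x in M. (\<lambda>i. (u x - U i x)\<^sup>2) \<longlonglongrightarrow> 0"
      using lim by (intro AE_I2) (auto intro!: tendsto_eq_intros)
    show "AE x in M. norm ((u x - U i x)\<^sup>2) \<le> (w x)\<^sup>2" for i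
      using bound by (intro AE_I2) (simp add: abs_le_square_iff)
  qed (use u U in measurable)
  then have "(\<lambda>i. sqrt (\<integral>x. (u x - U i x)\<^sup>2 \<partial>M)) \<longlonglongrightarrow> sqrt 0"
    by (intro tendsto_real_sqrt) simp
  then show ?thesis by (simp add: nrm_def ip_def power2_eq_square)
qed

text \<open>The closure of \<open>V\<close> is a linear space, closed under norm limits and
  containing the indicators. Induction over nonnegative functions and the split into positive and
  negative part give all of \<open>L2\<close>.\<close>

lemma (in finite_measure) L2_dense:
  assumes V: "V \<subseteq> L2 M"
    and Vadd: "\<And>u v. u \<in> V \<Longrightarrow> v \<in> V \<Longrightarrow> (\<lambda>x. u x + v x) \<in> V"
    and Vscale: "\<And>u c. u \<in> V \<Longrightarrow> (\<lambda>x. c * u x) \<in> V"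
    and Vind: "\<And>A e. A \<in> sets M \<Longrightarrow> e > 0 \<Longrightarrow> \<exists>v\<in>V. nrm M (\<lambda>x. indicator A x - v x) < e"
    and u: "u \<in> L2 M" and e: "e > 0"
  shows "\<exists>v\<in>V. nrm M (\<lambda>x. u x - v x) < e"
proof -
  define K where "K = {u \<in> L2 M. \<forall>e>0. \<exists>v\<in>V. nrm M (\<lambda>x. u x - v x) < e}"
  have VL: "v \<in> L2 M" if "v \<in> V" for v using that V by auto
  have KD: "\<exists>v\<in>V. nrm M (\<lambda>x. u x - v x) < e/2" if "u \<in> K" "e > 0" for u e
    using that half_gt_zero[of e] unfolding K_def by blast
  have Kadd: "(\<lambda>x. u x + v x) \<in> K" if u: "u \<in> K" and v: "v \<in> K" for u v
    unfolding K_def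
  proof (intro CollectI conjI allI impI)
    fix e :: real assume e: "e > 0"
    obtain u' v' where uv: "u' \<in> V" "nrm M (\<lambda>x. u x - u' x) < e/2" "v' \<in> V" "nrm M (\<lambda>x. v x - v' x) < e/2"
      using KD[OF u e] KD[OF v e] by blast
    have "nrm M (\<lambda>x. (u x - u' x) + (v x - v' x)) < e"
      using nrm_triangle[of "\<lambda>x. u x - u' x" M "\<lambda>x. v x - v' x"] uv u v VL by (simp add: K_def)
    then have "nrm M (\<lambda>x. (u x + v x) - (u' x + v' x)) < e"
      by (simp add: algebra_simps)
    then show "\<exists>w\<in>V. nrm M (\<lambda>x. (u x + v x) - w x) < e"
      using Vadd[OF uv(1,3)] by (intro bexI[where x = "\<lambda>x. u' x + v' x"])
  qed (use u v in \<open>simp add: K_def\<close>)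
  have Kscale: "(\<lambda>x. c * u x) \<in> K" if u: "u \<in> K" for u c
    unfolding K_def
  proof (intro CollectI conjI allI impI)
    fix e :: real assume e: "e > 0"
    have "e / (1 + \<bar>c\<bar>) > 0" using e by (simp add: divide_pos_pos add_pos_nonneg)
    then obtain v where v: "v \<in> V" "nrm M (\<lambda>x. u x - v x) < e / (1 + \<bar>c\<bar>)"
      using u unfolding K_def by blast
    have "nrm M (\<lambda>x. c * (u x - v x)) \<le> (1 + \<bar>c\<bar>) * nrm M (\<lambda>x. u x - v x)"
      unfolding nrm_scale by (intro mult_right_mono) auto
    also have "\<dots> < e"
      using v(2) by (simp add: pos_less_divide_eq add_pos_nonneg mult.commute)
    finally have "nrm M (\<lambda>x. c * u x - c * v x) < e"
      by (simp add: right_diff_distrib)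
    then show "\<exists>w\<in>V. nrm M (\<lambda>x. c * u x - w x) < e"
      using Vscale[OF v(1), of c] by (intro bexI[where x = "\<lambda>x. c * v x"])
  qed (use u in \<open>simp add: K_def\<close>)
  have Klim: "u \<in> K" if u: "u \<in> L2 M" and U: "\<And>i. U i \<in> K"
    and lim: "(\<lambda>i. nrm M (\<lambda>x. u x - U i x)) \<longlonglongrightarrow> 0" for u and U :: "nat \<Rightarrow> 'a \<Rightarrow> real"
    unfolding K_def
  proof (intro CollectI conjI allI impI)
    fix e :: real assume e: "e > 0"
    then have "\<forall>\<^sub>F i in sequentially. nrm M (\<lambda>x. u x - U i x) < e/2"
      using order_tendstoD(2)[OF lim, of "e/2"] by simp
    then obtain i where i: "nrm M (\<lambda>x. u x - U i x) < e/2"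
      by (auto dest: eventually_happens)
    obtain v where v: "v \<in> V" "nrm M (\<lambda>x. U i x - v x) < e/2"
      using KD[OF U e] by blast
    have "nrm M (\<lambda>x. u x - v x) < e"
      using nrm_triangle_diff[of u M "U i" v] u U[of i] VL v i by (simp add: K_def)
    then show "\<exists>w\<in>V. nrm M (\<lambda>x. u x - w x) < e" using v(1) by blast
  qed (fact u)
  have Kind: "indicator A \<in> K" if A: "A \<in> sets M" for A
    unfolding K_def using Vind[OF A] L2_indicator[OF A] by blast
  \<comment> \<open>The induction runs over measurable functions, so membership in \<open>L2\<close>
    is a premise inside the claim. It descends to summands and to the approximating functions by
    domination.\<close>
  have K_nonneg: "u \<in> L2 M \<longrightarrow> u \<in> K" if "u \<in> borel_measurable M" "\<And>x. 0 \<le> u x" for u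
    using that
  proof (induction rule: borel_measurable_induct_real)
    case (set A)
    then show ?case using Kind by simp
  next
    case (mult u c)
    show ?case
    \<comment> \<open>For c = 0 the multiple is in \<open>L2\<close> even if \<open>u\<close> is
      not, so the induction hypothesis cannot be applied.\<close>
    proof (cases "c = 0")
      case True
      then show ?thesis using Kscale[OF Kind[of "{}"], of 0] by simp
    next
      case False
      then have "u \<in> L2 M" if "(\<lambda>x. c * u x) \<in> L2 M"
        using L2_scale[OF that, of "1/c"] by simp
      then show ?thesis using mult Kscale by blast
    qed
  next
    case (add u v)
    show ?case
    proof
      assume L: "(\<lambda>x. v x + u x) \<in> L2 M"
      have "u \<in> L2 M" "v \<in> L2 M"
        using add by (auto intro!: L2_dominated[OF L])
      then show "(\<lambda>x. v x + u x) \<in> K" using add Kadd by blast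
    qed
  next
    case (seq U)
    show ?case
    proof
      assume L: "u \<in> L2 M"
      have le: "U i x \<le> u x" if "x \<in> space M" for i x
        using seq.hyps(3) seq.hyps(4)[OF that] by (intro incseq_le) (auto simp: incseq_def le_fun_def)
      have "U i \<in> L2 M" for i
        using seq le by (intro L2_dominated[OF L]) (auto intro: order_trans[OF _ abs_ge_self])
      then have UK: "U i \<in> K" for i using seq by blast
      show "u \<in> K"
      proof (rule Klim[OF L UK])
        show "(\<lambda>i. nrm M (\<lambda>x. u x - U i x)) \<longlonglongrightarrow> 0"
        proof (rule L2_dominated_convergence[OF L])
          fix i x assume x: "x \<in> space M"
          show "\<bar>u x - U i x\<bar> \<le> \<bar>u x\<bar>" using le[OF x, of i] seq.hyps(2)[of i x] by linarith
        qed (use seq L in \<open>auto intro: L2_measurable\<close>)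
      qed
    qed
  qed
  have "(\<lambda>x. max 0 (u x)) \<in> K" "(\<lambda>x. max 0 (- u x)) \<in> K"
    using u by (auto intro!: K_nonneg[rule_format] L2_dominated[OF u] intro: L2_measurable)
  from Kadd[OF this(1) Kscale[OF this(2), of "-1"]]
  have "(\<lambda>x. max 0 (u x) + - 1 * max 0 (- u x)) \<in> K" .
  moreover have "max 0 (u x) + - 1 * max 0 (- u x) = u x" for x by (simp add: max_def)
  ultimately show ?thesis using e by (simp add: K_def)
qed

text \<open>Translates the distance used in \<open>has_countable_base\<close> into the
  \<open>L2\<close> norm.\<close>

lemma nrm_indicator_diff:
  assumes "A \<in> sets M" "B \<in> sets M"
  shows "nrm M (\<lambda>x. indicator A x - indicator B x) = sqrt (measure M ((A - B) \<union> (B - A)))"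
proof -
  have "ip M (\<lambda>x. indicator A x - indicator B x) (\<lambda>x. indicator A x - indicator B x)
      = (\<integral>x. indicator ((A - B) \<union> (B - A)) x \<partial>M)"
    unfolding ip_def by (intro Bochner_Integration.integral_cong) (auto simp: indicator_def)
  also have "\<dots> = measure M ((A - B) \<union> (B - A))"
    using assms by (simp add: Int_absorb2 sets.sets_into_space)
  finally show ?thesis by (simp add: nrm_def)
qed

text \<open>For bounded f, Jensen gives (T f)^2 at most T(f^2), and integrating against the
  invariant measure gives the contraction. Invariance speaks of bounded functions only, so general u
  are reached by density and the boundedness of \<open>T t\<close>.\<close>

lemma (in prob_space) invariant_contraction_semigroup:
  fixes T :: "real \<Rightarrow> ('a \<Rightarrow> real) \<Rightarrow> 'a \<Rightarrow> real"
  assumes sg: "strongly_continuous_semigroup M T" and tf: "L2_transition_function M T P"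
    and inv: "invariant_measure M T"
  shows "contraction_semigroup M T"
  unfolding contraction_semigroup_def
proof (intro conjI allI impI ballI sg)
  fix t :: real and u :: "'a \<Rightarrow> real" assume t: "t \<ge> 0" and u: "u \<in> L2 M"
  define V :: "('a \<Rightarrow> real) set" where "V = {f \<in> borel_measurable M. \<exists>K. \<forall>x. \<bar>f x\<bar> \<le> K}"
  have V_L2: "f \<in> L2 M" if "f \<in> V" for f
    using that by (auto simp: V_def intro: L2_bounded)
  have TL: "T t f \<in> L2 M" if "f \<in> L2 M" for f
    using sg t that by (simp add: strongly_continuous_semigroup_def linear_operator_L2_def)
  have Tadd: "AE x in M. T t (\<lambda>y. f y + g y) x = T t f x + T t g x" if "f \<in> L2 M" "g \<in> L2 M" for f g
    using sg t that by (simp add: strongly_continuous_semigroup_def linear_operator_L2_def)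
  obtain L where L: "\<And>f. f \<in> L2 M \<Longrightarrow> nrm M (T t f) \<le> L * nrm M f"
  proof -
    have "\<exists>L. \<forall>f\<in>L2 M. nrm M (T t f) \<le> L * nrm M f"
      using sg t by (simp add: strongly_continuous_semigroup_def)
    then show ?thesis using that by blast
  qed
  have V_contr: "nrm M (T t f) \<le> nrm M f" if f: "f \<in> V" for f
  proof -
    have f2: "(\<lambda>x. (f x)\<^sup>2) \<in> V"
    proof -
      from f obtain K where K: "f \<in> borel_measurable M" "\<And>x. \<bar>f x\<bar> \<le> K" by (auto simp: V_def)
      have "\<bar>(f x)\<^sup>2\<bar> \<le> K\<^sup>2" for x using power_mono[OF K(2)[of x], of 2] by simp
      with K(1) show ?thesis by (auto simp: V_def)
    qed
    have kern: "AE x in M. integrable (P t x) h \<and> T t h x = (\<integral>y. h y \<partial>P t x)" if "h \<in> L2 M" for h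
      using tf t that by (simp add: L2_transition_function_def)
    have Pt: "prob_space (P t x)" if "x \<in> space M" for x
      using tf t that measurable_space[of "P t" M "prob_algebra M" x]
      by (simp add: L2_transition_function_def transition_kernel_def space_prob_algebra)
    have Jensen: "AE x in M. (T t f x)\<^sup>2 \<le> T t (\<lambda>x. (f x)\<^sup>2) x"
      using kern[OF V_L2[OF f]] kern[OF V_L2[OF f2]] AE_space
    proof eventually_elim
      case (elim x)
      interpret Px: prob_space "P t x" using Pt elim by simp
      show ?case
        \<comment> \<open>Jensen's inequality for the square is the nonnegativity of the variance of
          \<open>f\<close> under \<open>P t x\<close>.\<close>
        using Px.variance_eq[of f] Px.variance_positive[of f] elim by simp
    qed
    have "(nrm M (T t f))\<^sup>2 = (\<integral>x. (T t f x)\<^sup>2 \<partial>M)"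
      unfolding nrm_square by (simp add: ip_def power2_eq_square)
    also have "\<dots> \<le> (\<integral>x. T t (\<lambda>x. (f x)\<^sup>2) x \<partial>M)"
      using Jensen f f2 by (intro integral_mono_AE L2_integrable_square L2_integrable TL V_L2)
    also have "\<dots> = (\<integral>x. (f x)\<^sup>2 \<partial>M)"
    proof -
      have "(\<lambda>x. (f x)\<^sup>2) \<in> Linf M"
        using f2 unfolding Linf_def V_def by (blast intro: AE_I2)
      then show ?thesis using inv t by (simp add: invariant_measure_def)
    qed
    also have "\<dots> = (nrm M f)\<^sup>2"
      unfolding nrm_square by (simp add: ip_def power2_eq_square)
    finally show ?thesis by (rule power2_le_imp_le) simp
  qed
  show "nrm M (T t u) \<le> nrm M u"
  proof (rule field_le_epsilon)
    fix e :: real assume e: "e > 0"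
    \<comment> \<open>\<open>2 + \<bar>L\<bar>\<close> dominates the factor
      \<open>1 + \<bar>L\<bar>\<close> that arises below, one part from T(u - f) and one from
      replacing f by u.\<close>
    define e' where "e' = e / (2 + \<bar>L\<bar>)"
    have e': "e' > 0" using e by (simp add: e'_def add_pos_nonneg)
    have "\<exists>f\<in>V. nrm M (\<lambda>x. u x - f x) < e'"
    proof (rule L2_dense[OF _ _ _ _ u e'])
      show "(\<lambda>x. f x + g x) \<in> V" if "f \<in> V" "g \<in> V" for f g
      proof -
        from that obtain K K' where "\<And>x. \<bar>f x\<bar> \<le> K" "\<And>x. \<bar>g x\<bar> \<le> K'" by (auto simp: V_def)
        then have "\<bar>f x + g x\<bar> \<le> K + K'" for x by (meson abs_triangle_ineq add_mono order_trans)
        then show ?thesis using that by (auto simp: V_def)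
      qed
      show "(\<lambda>x. c * f x) \<in> V" if "f \<in> V" for f c
      proof -
        from that obtain K where "\<And>x. \<bar>f x\<bar> \<le> K" by (auto simp: V_def)
        then have "\<bar>c * f x\<bar> \<le> \<bar>c\<bar> * K" for x by (simp add: abs_mult mult_left_mono)
        then show ?thesis using that by (auto simp: V_def)
      qed
      show "\<exists>v\<in>V. nrm M (\<lambda>x. indicator A x - v x) < d" if "A \<in> sets M" "d > 0" for A and d :: real
        using that by (intro bexI[of _ "indicator A"]) (auto simp: V_def nrm_def ip_def indicator_def)
    qed (use V_L2 in auto)
    then obtain f where f: "f \<in> V" "nrm M (\<lambda>x. u x - f x) < e'" by blast
    note fL = V_L2[OF f(1)]
    have "nrm M (T t u) = nrm M (\<lambda>x. T t (\<lambda>x. u x - f x) x + T t f x)"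
      using Tadd[of "\<lambda>x. u x - f x" f] u fL
      by (intro nrm_cong_AE L2_measurable L2_add TL) auto
    also have "\<dots> \<le> nrm M (T t (\<lambda>x. u x - f x)) + nrm M (T t f)"
      using u fL by (intro nrm_triangle TL) auto
    also have "\<dots> \<le> \<bar>L\<bar> * nrm M (\<lambda>x. u x - f x) + nrm M f"
      using u fL by (intro add_mono order_trans[OF L] V_contr f mult_right_mono) auto
    also have "nrm M f \<le> nrm M u + nrm M (\<lambda>x. u x - f x)"
      using nrm_reverse_triangle[OF u fL] by linarith
    also have "\<bar>L\<bar> * nrm M (\<lambda>x. u x - f x) + (nrm M u + nrm M (\<lambda>x. u x - f x))
        = nrm M u + (1 + \<bar>L\<bar>) * nrm M (\<lambda>x. u x - f x)" by (simp add: algebra_simps)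
    also have "\<dots> \<le> nrm M u + (2 + \<bar>L\<bar>) * e'"
      using f(2) by (intro add_left_mono mult_mono) auto
    also have "\<dots> = nrm M u + e"
      by (simp add: e'_def add_nonneg_eq_0_iff)
    finally show "nrm M (T t u) \<le> nrm M u + e" by simp
  qed
qed

text \<open>Bolzano-Weierstrass in each coordinate, then a diagonal sequence.\<close>

lemma diagonal_convergent_subsequence:
  fixes X :: "nat \<Rightarrow> nat \<Rightarrow> real"
  assumes "\<And>j. Bseq (\<lambda>n. X n j)"
  shows "\<exists>r :: nat \<Rightarrow> nat. strict_mono r \<and> (\<forall>j. convergent (\<lambda>k. X (r k) j))"
proof -
  interpret S: subseqs "\<lambda>j r. convergent (\<lambda>k. X (r k) j)"
  proof
    fix j and s :: "nat \<Rightarrow> nat" assume "strict_mono s"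
    have "bounded (range (\<lambda>k. X (s k) j))"
      using assms[of j] unfolding Bseq_eq_bounded by (rule bounded_subset) auto
    then obtain l r where "strict_mono r" "((\<lambda>k. X (s k) j) \<circ> r) \<longlonglongrightarrow> l"
      using bounded_imp_convergent_subsequence by blast
    then show "\<exists>r'. strict_mono r' \<and> convergent (\<lambda>k. X ((s \<circ> r') k) j)"
      by (auto simp: o_def convergent_def)
  qed
  have "convergent (\<lambda>k. X (S.diagseq k) j)" for j
  proof -
    \<comment> \<open>The diagonal sequence refines the \<open>j\<close>-th selection only from
      index \<open>Suc j\<close> on; the initial segment is discarded afterwards.\<close>
    have "convergent (\<lambda>k. X ((S.diagseq \<circ> ((+) (Suc j))) k) j)"
    proof (rule S.diagseq_holds)
      fix r s :: "nat \<Rightarrow> nat" and n assume "strict_mono r" "convergent (\<lambda>k. X (s k) n)"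
      then show "convergent (\<lambda>k. X ((s \<circ> r) k) n)"
        using convergent_subseq_convergent[of "\<lambda>k. X (s k) n" r] by (simp add: o_def)
    qed
    then have "convergent (\<lambda>k. X (S.diagseq (k + Suc j)) j)"
      by (simp add: o_def add.commute)
    then show ?thesis by (rule convergent_ignore_initial_segment[THEN iffD1])
  qed
  with S.subseq_diagseq show ?thesis by blast
qed

lemma norm_convergent_fnsD:
  assumes "u \<in> norm_convergent_fns N Ns"
  shows "u \<in> L2 N" "u \<in> L2 (Ns n)" "(\<lambda>n. ip (Ns n) u u) \<longlonglongrightarrow> ip N u u"
    "(\<lambda>n. nrm (Ns n) u) \<longlonglongrightarrow> nrm N u"
  using assms by (auto simp: norm_convergent_fns_def nrm_def intro: tendsto_real_sqrt)

text \<open>Replaces weak compactness of balls across varying spaces. Pairings with countably many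
  elements of \<open>C\<close> converge after diagonal selection, density extends this to
  \<open>C\<close>, and the limit functional is bounded by \<open>K * nrm N u\<close> because norms
  of elements of \<open>C\<close> converge. Riesz then yields \<phi>, possibly outside
  \<open>C\<close>.\<close>

lemma weakly_convergent_subsequence:
  assumes N: "prob_space N" and base: "has_countable_base N"
    and C: "linear_class_set M C" "C \<subseteq> norm_convergent_fns N Ns" "dense_in_L2 C N"
    and f: "\<And>n. f n \<in> C" and K: "\<And>n. nrm (Ns n) (f n) \<le> K"
  obtains r \<phi> where "strict_mono (r :: nat \<Rightarrow> nat)" "w_converges C (\<lambda>k. Ns (r k)) N (\<lambda>k. f (r k)) \<phi>"
proof -
  interpret prob_space N by (fact N)
  have C0: "(\<lambda>x. 0) \<in> C" and Cadd: "\<And>u v. u \<in> C \<Longrightarrow> v \<in> C \<Longrightarrow> (\<lambda>x. u x + v x) \<in> C"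
    and Cscale: "\<And>u c. u \<in> C \<Longrightarrow> (\<lambda>x. c * u x) \<in> C"
    using C(1) by (auto simp: linear_class_set_def)
  have Cdiff: "(\<lambda>x. u x - v x) \<in> C" if "u \<in> C" "v \<in> C" for u v
    using Cadd[OF that(1) Cscale[OF that(2), of "-1"]] by simp
  have CL: "u \<in> L2 N" and CLs: "u \<in> L2 (Ns n)" and Cnrm: "(\<lambda>n. nrm (Ns n) u) \<longlonglongrightarrow> nrm N u"
    if "u \<in> C" for u n
    using that C(2) norm_convergent_fnsD by blast+
  have K0: "K \<ge> 0" using order_trans[OF nrm_nonneg K] .
  have ip_le: "\<bar>ip (Ns n) (f n) c\<bar> \<le> K * nrm (Ns n) c" if "c \<in> C" for n c
    using order_trans[OF ip_Cauchy_Schwarz mult_right_mono[OF K nrm_nonneg]] CLs f that by blast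
  obtain \<A> where \<A>: "countable \<A>" "\<A> \<subseteq> sets N"
    "\<And>B e. B \<in> sets N \<Longrightarrow> e > 0 \<Longrightarrow> \<exists>A\<in>\<A>. measure N ((A - B) \<union> (B - A)) < e"
    using base unfolding has_countable_base_def by blast
  have ne: "\<A> \<noteq> {}" using \<A>(3)[of "{}" 1] by auto
  define a where "a = from_nat_into \<A>"
  have a: "range a = \<A>" unfolding a_def by (rule range_from_nat_into[OF ne \<A>(1)])
  \<comment> \<open>Indicators of the countable base need not lie in \<open>C\<close>, so each is
    approximated to every accuracy \<open>inverse (Suc m)\<close> by elements of
    \<open>C\<close>.\<close>
  have "\<exists>c. c \<in> C \<and> nrm N (\<lambda>x. indicator (a j) x - c x) < inverse (Suc m)" for j m
  proof -
    have "indicator (a j) \<in> L2 N"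
      using a \<A>(2) by (auto intro!: L2_indicator)
    then show ?thesis
      using C(3) unfolding dense_in_L2_def by (meson inverse_positive_iff_positive of_nat_0_less_iff zero_less_Suc)
  qed
  then obtain c where c: "\<And>j m. c j m \<in> C"
    "\<And>j m. nrm N (\<lambda>x. indicator (a j) x - c j m x) < inverse (Suc m)" by metis
  define X where "X n i = ip (Ns n) (f n) (case_prod c (prod_decode i))" for n i
  have bX: "Bseq (\<lambda>n. X n i)" for i
  proof -
    have cC: "case_prod c (prod_decode i) \<in> C" using c(1) by (simp split: prod.split)
    have "Bseq (\<lambda>n. K * nrm (Ns n) (case_prod c (prod_decode i)))"
      using tendsto_mult_left[OF Cnrm[OF cC]] by (intro convergent_imp_Bseq) (auto simp: convergent_def)
    then show ?thesis
      unfolding X_def by (rule Bseq_eventually_mono[rotated])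
        (use ip_le[OF cC] in \<open>auto intro!: always_eventually intro: order_trans[OF _ abs_ge_self]\<close>)
  qed
  obtain r where r: "strict_mono r" and conv: "\<And>i. convergent (\<lambda>k. X (r k) i)"
    using diagonal_convergent_subsequence[of X] bX by auto
  let ?X = "\<lambda>u k. ip (Ns (r k)) (f (r k)) u"
  define V where "V = {u \<in> C. convergent (?X u)}"
  have Xadd: "?X (\<lambda>x. u x + v x) = (\<lambda>k. ?X u k + ?X v k)"
    and Xdiff: "?X (\<lambda>x. u x - v x) = (\<lambda>k. ?X u k - ?X v k)" if "u \<in> C" "v \<in> C" for u v
    using that by (auto simp: ip_add_right ip_diff_right CLs f)
  have Xscale: "?X (\<lambda>x. b * u x) = (\<lambda>k. b * ?X u k)" for b u
    by (simp add: ip_scale_right)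
  have cV: "c j m \<in> V" for j m
    using conv[of "prod_encode (j, m)"] c(1) by (simp add: V_def X_def)
  have dense: "\<exists>v\<in>V. nrm N (\<lambda>x. u x - v x) < e" if "u \<in> C" and e: "e > 0" for u e
  proof (rule L2_dense[OF _ _ _ _ CL[OF that(1)] e])
    show "V \<subseteq> L2 N" using CL by (auto simp: V_def)
    show "(\<lambda>x. u x + v x) \<in> V" if "u \<in> V" "v \<in> V" for u v
      using that by (simp add: V_def Cadd Xadd convergent_add)
    show "(\<lambda>x. b * u x) \<in> V" if "u \<in> V" for u b
      using that Xscale[of b u] by (simp add: V_def Cscale convergent_mult convergent_const)
    show "\<exists>v\<in>V. nrm N (\<lambda>x. indicator A x - v x) < d" if A: "A \<in> sets N" and d: "d > 0" for A and d :: real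
    proof -
      obtain m where m: "inverse (real (Suc m)) < d/2"
        using reals_Archimedean[of "d/2"] d by auto
      \<comment> \<open>Squared, because the distance of two indicators is the square root of the
        measure of their symmetric difference.\<close>
      have "(d/2)\<^sup>2 > 0" using d by simp
      then obtain j where j: "measure N ((a j - A) \<union> (A - a j)) < (d/2)\<^sup>2"
        using \<A>(3)[OF A] a by (metis rangeE)
      have aj: "a j \<in> sets N" using a \<A>(2) by auto
      have "nrm N (\<lambda>x. indicator A x - indicator (a j) x) < d/2"
        unfolding nrm_indicator_diff[OF A aj]
        using real_sqrt_less_mono[OF j] d by (simp add: Un_commute)
      moreover have "nrm N (\<lambda>x. indicator A x - c j m x)
          \<le> nrm N (\<lambda>x. indicator A x - indicator (a j) x) + nrm N (\<lambda>x. indicator (a j) x - c j m x)"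
        using A aj by (intro nrm_triangle_diff L2_indicator CL c(1))
      ultimately have "nrm N (\<lambda>x. indicator A x - c j m x) < d"
        using c(2)[of j m] m by linarith
      then show ?thesis using cV by blast
    qed
  qed
  have all_conv: "convergent (?X u)" if u: "u \<in> C" for u
  proof -
    have "Cauchy (?X u)"
    proof (rule CauchyI)
      fix e :: real assume e: "e > 0"
      \<comment> \<open>One third of \<open>e\<close> for each of three errors; \<open>K + 1\<close>
        avoids division by zero when \<open>K = 0\<close>.\<close>
      define d where "d = e / (3 * (K + 1))"
      have d: "d > 0" "K * d \<le> e / 3" using e K0 by (auto simp: d_def field_simps)
      obtain v where v: "v \<in> V" "nrm N (\<lambda>x. u x - v x) < d" using dense[OF u d(1)] by blast
      then have vC: "v \<in> C" and vc: "Cauchy (?X v)" by (auto simp: V_def convergent_Cauchy)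
      \<comment> \<open>Since \<open>u - v\<close> is again in \<open>C\<close>, closeness in
        \<open>N\<close> becomes closeness in \<open>Ns (r k)\<close> for large
        \<open>k\<close>.\<close>
      have "(\<lambda>k. nrm (Ns (r k)) (\<lambda>x. u x - v x)) \<longlonglongrightarrow> nrm N (\<lambda>x. u x - v x)"
        using LIMSEQ_subseq_LIMSEQ[OF Cnrm[OF Cdiff[OF u vC]] r] by (simp add: o_def)
      then have "\<forall>\<^sub>F k in sequentially. nrm (Ns (r k)) (\<lambda>x. u x - v x) < d"
        using v(2) by (rule order_tendstoD)
      then obtain k0 where k0: "\<And>k. k \<ge> k0 \<Longrightarrow> nrm (Ns (r k)) (\<lambda>x. u x - v x) < d"
        by (auto simp: eventually_sequentially)
      obtain k1 where k1: "\<And>k l. k \<ge> k1 \<Longrightarrow> l \<ge> k1 \<Longrightarrow> \<bar>?X v k - ?X v l\<bar> < e / 3"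
        using CauchyD[OF vc, of "e/3"] e by auto
      have near: "\<bar>?X u k - ?X v k\<bar> \<le> e / 3" if "k \<ge> k0" for k
      proof -
        have "\<bar>?X u k - ?X v k\<bar> \<le> K * nrm (Ns (r k)) (\<lambda>x. u x - v x)"
          using ip_le[OF Cdiff[OF u vC], of "r k"] fun_cong[OF Xdiff[OF u vC], of k] by simp
        also have "\<dots> \<le> K * d" using k0[OF that] K0 by (intro mult_left_mono) auto
        finally show ?thesis using d(2) by simp
      qed
      have "norm (?X u k - ?X u l) < e" if "k \<ge> max k0 k1" "l \<ge> max k0 k1" for k l
      proof -
        have "\<bar>?X u k - ?X v k\<bar> \<le> e / 3" "\<bar>?X u l - ?X v l\<bar> \<le> e / 3" "\<bar>?X v k - ?X v l\<bar> < e / 3"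
          using near k1 that by auto
        then show ?thesis unfolding real_norm_def by linarith
      qed
      then show "\<exists>k0. \<forall>k\<ge>k0. \<forall>l\<ge>k0. norm (?X u k - ?X u l) < e" by blast
    qed
    then show ?thesis by (rule Cauchy_convergent)
  qed
  then have limX: "?X u \<longlonglongrightarrow> lim (?X u)" if "u \<in> C" for u
    using that by (simp add: convergent_LIMSEQ_iff)
  have "\<exists>\<phi>\<in>L2 N. \<forall>v\<in>C. lim (?X v) = ip N \<phi> v"
  proof (rule L2_Riesz[OF _ C0 Cadd Cscale])
    show "C \<subseteq> L2 N" using CL by auto
    show "lim (?X (\<lambda>x. u x + v x)) = lim (?X u) + lim (?X v)" if "u \<in> C" "v \<in> C" for u v
      unfolding Xadd[OF that] using that by (intro limI tendsto_add limX)
    show "lim (?X (\<lambda>x. b * u x)) = b * lim (?X u)" if "u \<in> C" for u b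
      unfolding Xscale using that by (intro limI tendsto_mult_left limX)
    show "\<bar>lim (?X u)\<bar> \<le> K * nrm N u" if u: "u \<in> C" for u
    proof (rule LIMSEQ_le)
      show "(\<lambda>k. \<bar>?X u k\<bar>) \<longlonglongrightarrow> \<bar>lim (?X u)\<bar>" by (intro tendsto_rabs limX u)
      show "(\<lambda>k. K * nrm (Ns (r k)) u) \<longlonglongrightarrow> K * nrm N u"
        using LIMSEQ_subseq_LIMSEQ[OF Cnrm[OF u] r] by (intro tendsto_mult_left) (simp add: o_def)
    qed (use ip_le[OF u] in auto)
  qed
  then obtain \<phi> where \<phi>: "\<phi> \<in> L2 N" "\<And>v. v \<in> C \<Longrightarrow> lim (?X v) = ip N \<phi> v" by blast
  have "w_converges C (\<lambda>k. Ns (r k)) N (\<lambda>k. f (r k)) \<phi>"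
    unfolding w_converges_def using f \<phi> limX by auto
  with r show ?thesis by (rule that)
qed

text \<open>Lower semicontinuity of the norm. As \<phi> may lie outside \<open>C\<close>, it is
  replaced by a near \<open>c\<close> in \<open>C\<close>: (f,f) is at least 2 (f,c) - (c,c), whose
  limit is (\<phi>,\<phi>) minus the squared distance of \<phi> and c.\<close>

lemma w_converges_norm_lower_bound:
  assumes conv: "w_converges C Ns N f \<phi>" and C: "C \<subseteq> norm_convergent_fns N Ns" "dense_in_L2 C N"
    and e: "e > 0"
  shows "\<forall>\<^sub>F k in sequentially. ip N \<phi> \<phi> - e < ip (Ns k) (f k) (f k)"
proof -
  have \<phi>: "\<phi> \<in> L2 N" and f: "f k \<in> C" for k
    using conv by (auto simp: w_converges_def)
  obtain c where c: "c \<in> C" "nrm N (\<lambda>x. \<phi> x - c x) < sqrt e"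
    using C(2) \<phi> e unfolding dense_in_L2_def by (meson real_sqrt_gt_zero)
  have L: "c \<in> L2 N" "c \<in> L2 (Ns k)" "f k \<in> L2 (Ns k)" for k
    using norm_convergent_fnsD C(1) c(1) f by blast+
  have "(nrm N (\<lambda>x. \<phi> x - c x))\<^sup>2 < (sqrt e)\<^sup>2"
    using c(2) by (intro power_strict_mono) auto
  then have less: "ip N \<phi> \<phi> - e < 2 * ip N \<phi> c - ip N c c"
    using e \<phi> L by (simp add: nrm_square ip_diff_left ip_diff_right ip_commute[of N c \<phi>])
  have "(\<lambda>k. 2 * ip (Ns k) (f k) c - ip (Ns k) c c) \<longlonglongrightarrow> 2 * ip N \<phi> c - ip N c c"
    using conv C(1) c(1) by (intro tendsto_intros norm_convergent_fnsD(3)) (auto simp: w_converges_def)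
  from order_tendstoD(1)[OF this less] show ?thesis
  proof eventually_elim
    case (elim k)
    have "0 \<le> ip (Ns k) (\<lambda>x. f k x - c x) (\<lambda>x. f k x - c x)" by (rule ip_self_nonneg)
    with elim show ?case
      using L by (simp add: ip_diff_left ip_diff_right ip_commute[of "Ns k" c "f k"])
  qed
qed

lemma LIMSEQ_if_subsubsequence:
  fixes X :: "nat \<Rightarrow> 'a::metric_space"
  assumes "\<And>r :: nat \<Rightarrow> nat. strict_mono r \<Longrightarrow> \<exists>s :: nat \<Rightarrow> nat. strict_mono s \<and> (\<lambda>k. X (r (s k))) \<longlonglongrightarrow> L"
  shows "X \<longlonglongrightarrow> L"
proof (rule tendstoI, rule ccontr)
  fix e :: real assume e: "e > 0" and "\<not> (\<forall>\<^sub>F n in sequentially. dist (X n) L < e)"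
  then have inf: "infinite {n. \<not> dist (X n) L < e}"
    by (simp add: infinite_nat_iff_unbounded_le eventually_sequentially)
  define r where "r = enumerate {n. \<not> dist (X n) L < e}"
  have "strict_mono r" unfolding r_def using inf by (rule strict_mono_enumerate)
  then obtain s where "(\<lambda>k. X (r (s k))) \<longlonglongrightarrow> L" using assms by blast
  then have "\<forall>\<^sub>F k in sequentially. dist (X (r (s k))) L < e" using e by (rule tendstoD)
  moreover have "\<not> dist (X (r k)) L < e" for k
    using enumerate_in_set[OF inf, of k] by (simp add: r_def)
  ultimately show False by simp
qed

section \<open>Convergence of the resolvents\<close>

theorem theorem2p7:
  fixes \<nu> :: "'a measure" and \<nu>s :: "nat \<Rightarrow> 'a measure"
    and \<alpha> :: "nat \<Rightarrow> real"
    and C :: "('a \<Rightarrow> real) set"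
    and T Tb :: "real \<Rightarrow> ('a \<Rightarrow> real) \<Rightarrow> 'a \<Rightarrow> real"
    and Ts :: "nat \<Rightarrow> real \<Rightarrow> ('a \<Rightarrow> real) \<Rightarrow> 'a \<Rightarrow> real"
    and P :: "real \<Rightarrow> 'a \<Rightarrow> 'a measure"
    and Ps :: "nat \<Rightarrow> real \<Rightarrow> 'a \<Rightarrow> 'a measure"
  assumes sets_eq: "\<And>n. sets (\<nu>s n) = sets \<nu>"
    and prob: "prob_space \<nu>" "\<And>n. prob_space (\<nu>s n)"
    and singular: "\<And>n. mutually_singular (\<nu>s n) \<nu>"
      "\<And>m n. m \<noteq> n \<Longrightarrow> mutually_singular (\<nu>s m) (\<nu>s n)"
    and base: "has_countable_base \<nu>"
    and weights: "\<And>n. \<alpha> n > 0" "\<alpha> sums 1"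
    and C_linear: "linear_class_set (mixture \<alpha> \<nu> \<nu>s) C"
    and C_sub: "C \<subseteq> norm_convergent_fns \<nu> \<nu>s"
    and Ts_semigroup: "\<And>n. strongly_continuous_semigroup (\<nu>s n) (Ts n)"
    and Ts_kernel: "\<And>n. L2_transition_function (\<nu>s n) (Ts n) (Ps n)"
    and Ts_invariant: "\<And>n. invariant_measure (\<nu>s n) (Ts n)"
    and Tb_semigroup: "Bb_semigroup \<nu> Tb"
    and Tb_kernel: "Bb_transition_function \<nu> Tb P"
    and T_kernel: "L2_transition_function \<nu> T P"
    and T_semigroup: "contraction_semigroup \<nu> T"
    and C1: "dense_in_L2 C \<nu>"
    and C2: "\<And>g \<beta>. g \<in> C \<inter> bounded_measurable \<nu> \<Longrightarrow> \<beta> > 0 \<Longrightarrow>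
      (\<exists>u\<in>C. AE x in \<nu>. resolvent \<nu> T \<beta> g x = u x) \<and>
      (\<forall>n. \<exists>v\<in>C. AE x in \<nu>s n. resolvent (\<nu>s n) (Ts n) \<beta> g x = v x)"
    and i: "\<And>\<phi> r \<phi>s. \<phi> \<in> L2 \<nu> \<Longrightarrow> strict_mono (r :: nat \<Rightarrow> nat) \<Longrightarrow>
      (\<And>k. \<phi>s k \<in> C) \<Longrightarrow> w_converges C (\<lambda>k. \<nu>s (r k)) \<nu> \<phi>s \<phi> \<Longrightarrow>
      form \<nu> T \<phi> \<phi> \<le> liminf (\<lambda>k. form (\<nu>s (r k)) (Ts (r k)) (\<phi>s k) (\<phi>s k))"
    and ii: "\<And>\<psi>. \<psi> \<in> form_dom \<nu> T \<Longrightarrow>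
      \<exists>\<psi>s. (\<forall>n. \<psi>s n \<in> form_dom (\<nu>s n) (Ts n) \<inter> C) \<and> s_converges C \<nu>s \<nu> \<psi>s \<psi> \<and>
        limsup (\<lambda>n. form (\<nu>s n) (Ts n) (\<psi>s n) (\<psi>s n)) \<le> form \<nu> T \<psi> \<psi>"
    and iii: "\<And>g \<beta> \<psi> \<psi>s. g \<in> C \<inter> bounded_measurable \<nu> \<Longrightarrow> \<beta> > 0 \<Longrightarrow>
      \<psi> \<in> form_dom \<nu> T \<Longrightarrow> (\<And>n. \<psi>s n \<in> form_dom (\<nu>s n) (Ts n) \<inter> C) \<Longrightarrow>
      s_converges C \<nu>s \<nu> \<psi>s \<psi> \<Longrightarrow>
      limsup (\<lambda>n. form (\<nu>s n) (Ts n) (\<psi>s n) (\<psi>s n)) \<le> form \<nu> T \<psi> \<psi> \<Longrightarrow>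
      (\<lambda>n. form_shift (\<nu>s n) (Ts n) \<beta> (\<psi>s n) (resolvent (\<nu>s n) (Ts n) \<beta> g))
        \<longlonglongrightarrow> form_shift \<nu> T \<beta> \<psi> (resolvent \<nu> T \<beta> g)"
  shows "\<forall>g \<in> C \<inter> bounded_measurable \<nu>. \<forall>\<beta>>0. \<forall>v.
      (\<forall>n. v n \<in> C \<and> (AE x in \<nu>s n. resolvent (\<nu>s n) (Ts n) \<beta> g x = v n x)) \<longrightarrow>
      s_converges C \<nu>s \<nu> v (resolvent \<nu> T \<beta> g)"
proof (intro ballI allI impI)
  fix g v and \<beta> :: real
  assume g: "g \<in> C \<inter> bounded_measurable \<nu>" and \<beta>: "\<beta> > 0"
    and v: "\<forall>n. v n \<in> C \<and> (AE x in \<nu>s n. resolvent (\<nu>s n) (Ts n) \<beta> g x = v n x)"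
  interpret S: L2_contraction_semigroup \<nu> T
    by (intro L2_contraction_semigroup.intro L2_contraction_semigroup_axioms.intro prob T_semigroup)
  interpret Sn: L2_contraction_semigroup "\<nu>s n" "Ts n" for n
    by (intro L2_contraction_semigroup.intro L2_contraction_semigroup_axioms.intro prob
        prob_space.invariant_contraction_semigroup[OF prob(2) Ts_semigroup Ts_kernel Ts_invariant])

  \<comment> \<open>The resolvents as elements of the form domains\<close>
  define u where "u = resolvent \<nu> T \<beta> g"
  define b where "b w z = real_of_ereal (form \<nu> T w z)" for w z
  define bn where "bn n w z = real_of_ereal (form (\<nu>s n) (Ts n) w z)" for n w z
  have gC: "g \<in> C" using g by simp
  have vC: "v n \<in> C" for n using v by simp
  have Cadd: "(\<lambda>x. w x + c * z x) \<in> C" if "w \<in> C" "z \<in> C" for w z and c :: real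
    using C_linear that by (simp add: linear_class_set_def)
  have CL: "w \<in> L2 \<nu>" "w \<in> L2 (\<nu>s n)" if "w \<in> C" for w n
    using norm_convergent_fnsD C_sub that by blast+
  note gL = CL[OF gC] and vL = CL(2)[OF vC]
  have uL: "u \<in> L2 \<nu>" and u_deriv: "strong_derivative_at_0 \<nu> T u (\<lambda>x. \<beta> * u x - g x)"
    unfolding u_def using S.resolvent_spec[OF gL(1) \<beta>] by auto
  have u_dom: "u \<in> form_dom \<nu> T" by (rule S.strong_derivative_form_dom[OF uL u_deriv])
  have b_u: "b u w = ip \<nu> g w - \<beta> * ip \<nu> u w" if "w \<in> L2 \<nu>" for w
    using S.strong_derivative_form[OF uL u_deriv that] that uL gL
    by (simp add: b_def ip_diff_left ip_scale_left)
  have v_deriv: "strong_derivative_at_0 (\<nu>s n) (Ts n) (v n) (\<lambda>x. \<beta> * v n x - g x)" for n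
  proof (rule Sn.strong_derivative_cong[OF Sn.resolvent_spec(2)[OF gL(2) \<beta>] Sn.resolvent_spec(1)[OF gL(2) \<beta>] vL])
    show "AE x in \<nu>s n. resolvent (\<nu>s n) (Ts n) \<beta> g x = v n x" using v by simp
    then show "AE x in \<nu>s n. \<beta> * resolvent (\<nu>s n) (Ts n) \<beta> g x - g x = \<beta> * v n x - g x"
      by eventually_elim simp
  qed (use vL gL in simp)
  have v_dom: "v n \<in> form_dom (\<nu>s n) (Ts n)" for n
    by (rule Sn.strong_derivative_form_dom[OF vL v_deriv])
  have bn_v: "bn n (v n) w = ip (\<nu>s n) g w - \<beta> * ip (\<nu>s n) (v n) w" if "w \<in> L2 (\<nu>s n)" for n w
    using Sn.strong_derivative_form[OF vL v_deriv that] that vL gL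
    by (simp add: bn_def ip_diff_left ip_scale_left)
  have form_b: "form \<nu> T w z = ereal (b w z)" if "w \<in> form_dom \<nu> T" for w z
    unfolding b_def by (rule S.form_real[OF that])
  have form_bn: "form (\<nu>s n) (Ts n) w z = ereal (bn n w z)" if "w \<in> form_dom (\<nu>s n) (Ts n)" for n w z
    unfolding bn_def by (rule Sn.form_real[OF that])

  \<comment> \<open>Uniform norm bound for the resolvents\<close>
  have "Bseq (\<lambda>n. nrm (\<nu>s n) g)"
    using norm_convergent_fnsD(4) C_sub gC by (blast intro: convergent_imp_Bseq convergentI)
  then obtain K where K: "\<And>n. nrm (\<nu>s n) g \<le> K"
    unfolding Bseq_def by auto
  have v_bound: "nrm (\<nu>s n) (v n) \<le> K / \<beta>" for n
  proof (cases "nrm (\<nu>s n) (v n) = 0")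
    case True
    then show ?thesis using order_trans[OF nrm_nonneg K] \<beta> by simp
  next
    case False
    then have pos: "nrm (\<nu>s n) (v n) > 0" by (simp add: less_le)
    \<comment> \<open>The resolvent equation tested with \<open>v n\<close>, after dropping the
      nonnegative form term.\<close>
    have "\<beta> * ip (\<nu>s n) (v n) (v n) \<le> ip (\<nu>s n) g (v n)"
      using Sn.form_nonneg[OF v_dom] bn_v[OF vL] by (simp add: bn_def)
    also have "\<dots> \<le> nrm (\<nu>s n) g * nrm (\<nu>s n) (v n)"
      using ip_Cauchy_Schwarz[OF gL(2) vL] by (rule order_trans[OF abs_ge_self])
    also have "\<dots> \<le> K * nrm (\<nu>s n) (v n)" by (intro mult_right_mono K) simp
    finally have "(\<beta> * nrm (\<nu>s n) (v n)) * nrm (\<nu>s n) (v n) \<le> K * nrm (\<nu>s n) (v n)"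
      by (simp add: power2_eq_square mult.assoc flip: nrm_square)
    then show ?thesis using pos \<beta> by (simp add: field_simps)
  qed

  \<comment> \<open>Identification of w-limits of subsequences\<close>
  have identify: "(\<forall>c\<in>C. ip \<nu> \<phi> c = ip \<nu> u c) \<and>
      (\<lambda>k. ip (\<nu>s (q k)) (v (q k)) (v (q k))) \<longlonglongrightarrow> ip \<nu> u u"
    if q: "strict_mono (q :: nat \<Rightarrow> nat)"
      and \<phi>_conv: "w_converges C (\<lambda>k. \<nu>s (q k)) \<nu> (\<lambda>k. v (q k)) \<phi>" for q \<phi>
  proof -
    have \<phi>L: "\<phi> \<in> L2 \<nu>" and v_lim: "\<And>c. c \<in> C \<Longrightarrow> (\<lambda>k. ip (\<nu>s (q k)) (v (q k)) c) \<longlonglongrightarrow> ip \<nu> \<phi> c"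
      using \<phi>_conv by (auto simp: w_converges_def)
    have g_v_lim: "(\<lambda>k. ip (\<nu>s (q k)) g (v (q k))) \<longlonglongrightarrow> ip \<nu> g \<phi>"
      using v_lim[OF gC] by (simp add: ip_commute[of _ g])
    have "form \<nu> T \<phi> \<phi> \<le> liminf (\<lambda>k. form (\<nu>s (q k)) (Ts (q k)) (v (q k)) (v (q k)))"
      by (rule i[OF \<phi>L q vC \<phi>_conv])
    also have "\<dots> \<le> liminf (\<lambda>k. ereal (ip (\<nu>s (q k)) g (v (q k))))"
      using \<beta> by (intro Liminf_mono always_eventually allI)
        (simp add: form_bn[OF v_dom] bn_v[OF vL] ip_self_nonneg)
    also have "\<dots> = ereal (ip \<nu> g \<phi>)"
      using g_v_lim by (intro lim_imp_Liminf) auto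
    \<comment> \<open>The form is infinite outside its domain, so a finite upper bound places \<phi>
      inside.\<close>
    finally have \<phi>_dom: "\<phi> \<in> form_dom \<nu> T"
      by (auto simp: form_def split: if_splits)

    \<comment> \<open>One expansion serves twice: the bound for \<phi> - \<psi> identifies the
      limit, and the bound for \<open>v - \<psi>s\<close> with \<psi> = u gives norm convergence.
      Hence \<open>\<psi>s\<close> is part of the conclusion.\<close>
    have step: "\<exists>\<psi>s. s_converges C \<nu>s \<nu> \<psi>s \<psi> \<and>
        b (\<lambda>x. \<phi> x + (-1) * \<psi> x) (\<lambda>x. \<phi> x + (-1) * \<psi> x)
          + \<beta> * ip \<nu> (\<lambda>x. \<phi> x + (-1) * \<psi> x) (\<lambda>x. \<phi> x + (-1) * \<psi> x)
        \<le> ip \<nu> g \<phi> - ip \<nu> g \<psi> - (\<beta> * ip \<nu> \<psi> u + b \<psi> u) + \<beta> * ip \<nu> \<psi> \<psi> + b \<psi> \<psi> \<and>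
        (\<forall>e>0. \<forall>\<^sub>F k in sequentially.
          \<beta> * ip (\<nu>s (q k)) (\<lambda>x. v (q k) x + (-1) * \<psi>s (q k) x) (\<lambda>x. v (q k) x + (-1) * \<psi>s (q k) x)
          < ip \<nu> g \<phi> - ip \<nu> g \<psi> - (\<beta> * ip \<nu> \<psi> u + b \<psi> u) + \<beta> * ip \<nu> \<psi> \<psi> + b \<psi> \<psi> + e)"
      (is "\<exists>\<psi>s. _ \<and> b ?\<chi> ?\<chi> + \<beta> * ip \<nu> ?\<chi> ?\<chi> \<le> ?H + b \<psi> \<psi> \<and> _")
      if \<psi>: "\<psi> \<in> form_dom \<nu> T" for \<psi>
    proof -
      have \<psi>L: "\<psi> \<in> L2 \<nu>" using \<psi> by (simp add: form_dom_def)
      obtain \<psi>s where \<psi>s: "\<And>n. \<psi>s n \<in> form_dom (\<nu>s n) (Ts n) \<inter> C" "s_converges C \<nu>s \<nu> \<psi>s \<psi>"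
        "limsup (\<lambda>n. form (\<nu>s n) (Ts n) (\<psi>s n) (\<psi>s n)) \<le> form \<nu> T \<psi> \<psi>"
        using ii[OF \<psi>] by blast
      have \<psi>C: "\<psi>s n \<in> C" and \<psi>_dom: "\<psi>s n \<in> form_dom (\<nu>s n) (Ts n)" for n using \<psi>s(1) by auto
      note \<psi>sL = CL(2)[OF \<psi>C]
      have \<psi>_lim: "(\<lambda>k. ip (\<nu>s (q k)) (\<psi>s (q k)) c) \<longlonglongrightarrow> ip \<nu> \<psi> c" if "c \<in> C" for c
        using LIMSEQ_subseq_LIMSEQ[OF _ q, of "\<lambda>n. ip (\<nu>s n) (\<psi>s n) c"] \<psi>s(2) that
        by (simp add: s_converges_def w_converges_def o_def)
      have \<psi>\<psi>_lim: "(\<lambda>k. ip (\<nu>s (q k)) (\<psi>s (q k)) (\<psi>s (q k))) \<longlonglongrightarrow> ip \<nu> \<psi> \<psi>"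
        using LIMSEQ_subseq_LIMSEQ[OF _ q, of "\<lambda>n. ip (\<nu>s n) (\<psi>s n) (\<psi>s n)"] \<psi>s(2)
        by (simp add: s_converges_def o_def)
      have shift_lim: "(\<lambda>k. \<beta> * ip (\<nu>s (q k)) (\<psi>s (q k)) (v (q k)) + bn (q k) (\<psi>s (q k)) (v (q k)))
          \<longlonglongrightarrow> \<beta> * ip \<nu> \<psi> u + b \<psi> u"
      proof -
        have "form_shift (\<nu>s n) (Ts n) \<beta> (\<psi>s n) (resolvent (\<nu>s n) (Ts n) \<beta> g)
            = ereal (\<beta> * ip (\<nu>s n) (\<psi>s n) (v n) + bn n (\<psi>s n) (v n))" for n
        proof -
          have R: "resolvent (\<nu>s n) (Ts n) \<beta> g \<in> L2 (\<nu>s n)" and ae: "AE x in \<nu>s n. resolvent (\<nu>s n) (Ts n) \<beta> g x = v n x"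
            using Sn.resolvent_spec(1)[OF gL(2) \<beta>] v by auto
          have "ip (\<nu>s n) (\<psi>s n) (resolvent (\<nu>s n) (Ts n) \<beta> g) = ip (\<nu>s n) (\<psi>s n) (v n)"
            unfolding ip_commute[of _ "\<psi>s n"] using ae R vL \<psi>sL by (intro ip_cong_AE L2_measurable)
          then show ?thesis
            using Sn.form_cong_right[OF \<psi>_dom R vL ae] by (simp add: form_shift_def form_bn[OF \<psi>_dom])
        qed
        moreover have "form_shift \<nu> T \<beta> \<psi> (resolvent \<nu> T \<beta> g) = ereal (\<beta> * ip \<nu> \<psi> u + b \<psi> u)"
          by (simp add: form_shift_def form_b[OF \<psi>] u_def)
        ultimately have "(\<lambda>n. \<beta> * ip (\<nu>s n) (\<psi>s n) (v n) + bn n (\<psi>s n) (v n)) \<longlonglongrightarrow> \<beta> * ip \<nu> \<psi> u + b \<psi> u"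
          using iii[OF g \<beta> \<psi> \<psi>s] by simp
        from LIMSEQ_subseq_LIMSEQ[OF this q] show ?thesis by (simp add: o_def)
      qed
      define D where "D k = (\<lambda>x. v (q k) x + (-1) * \<psi>s (q k) x)" for k
      have DC: "D k \<in> C" for k unfolding D_def by (intro Cadd vC \<psi>C)
      have D_dom: "D k \<in> form_dom (\<nu>s (q k)) (Ts (q k))" for k
        unfolding D_def by (rule Sn.form_dom_combination[OF v_dom \<psi>_dom])
      have \<chi>L: "?\<chi> \<in> L2 \<nu>" using \<phi>L \<psi>L by (intro L2_add L2_scale)
      have \<chi>_dom: "?\<chi> \<in> form_dom \<nu> T" by (rule S.form_dom_combination[OF \<phi>_dom \<psi>])
      have D_conv: "w_converges C (\<lambda>k. \<nu>s (q k)) \<nu> D ?\<chi>"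
        unfolding w_converges_def
      proof (intro conjI allI ballI DC \<chi>L)
        fix c assume c: "c \<in> C"
        have "(\<lambda>k. ip (\<nu>s (q k)) (v (q k)) c + (-1) * ip (\<nu>s (q k)) (\<psi>s (q k)) c) \<longlonglongrightarrow> ip \<nu> \<phi> c + (-1) * ip \<nu> \<psi> c"
          by (intro tendsto_intros v_lim \<psi>_lim c)
        moreover have "ip (\<nu>s (q k)) (D k) c = ip (\<nu>s (q k)) (v (q k)) c + (-1) * ip (\<nu>s (q k)) (\<psi>s (q k)) c" for k
          unfolding D_def by (simp only: ip_add_left[OF vL L2_scale[OF \<psi>sL] CL(2)[OF c]] ip_scale_left)
        moreover have "ip \<nu> ?\<chi> c = ip \<nu> \<phi> c + (-1) * ip \<nu> \<psi> c"
          by (simp only: ip_add_left[OF \<phi>L L2_scale[OF \<psi>L] CL(1)[OF c]] ip_scale_left)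
        ultimately show "(\<lambda>k. ip (\<nu>s (q k)) (D k) c) \<longlonglongrightarrow> ip \<nu> ?\<chi> c" by simp
      qed
      \<comment> \<open>Everything in the expansion that has a limit. The diagonal form term of
        \<open>\<psi>s\<close> is kept apart, since (ii) bounds only its limsup.\<close>
      define H where "H k = ip (\<nu>s (q k)) g (v (q k)) - ip (\<nu>s (q k)) g (\<psi>s (q k))
        - (\<beta> * ip (\<nu>s (q k)) (\<psi>s (q k)) (v (q k)) + bn (q k) (\<psi>s (q k)) (v (q k)))
        + \<beta> * ip (\<nu>s (q k)) (\<psi>s (q k)) (\<psi>s (q k))" for k
      have H_lim: "H \<longlonglongrightarrow> ?H"
        unfolding H_def using \<psi>_lim[OF gC]
        by (intro tendsto_intros g_v_lim shift_lim \<psi>\<psi>_lim) (simp add: ip_commute[of _ g])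
      \<comment> \<open>\<open>bn_v\<close> evaluates both terms with \<open>v\<close> in the first
        slot; the term with \<open>v\<close> in the second slot stays in \<open>H\<close>, where
        (iii) gives its limit.\<close>
      have expand: "bn (q k) (D k) (D k) + \<beta> * ip (\<nu>s (q k)) (D k) (D k) = H k + bn (q k) (\<psi>s (q k)) (\<psi>s (q k))" for k
      proof -
        let ?n = "q k"
        let ?v = "v ?n" and ?\<psi> = "\<psi>s ?n"
        note L = vL[of ?n] \<psi>sL[of ?n]
        have "bn ?n (D k) (D k) = bn ?n ?v (D k) + (-1) * bn ?n ?\<psi> (D k)"
          using Sn.form_combination_left[OF v_dom[of ?n] \<psi>_dom[of ?n] CL(2)[OF DC[of k]], where c = "-1"]
          by (simp add: bn_def D_def)
        also have "bn ?n ?v (D k) = bn ?n ?v ?v + (-1) * bn ?n ?v ?\<psi>"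
          using Sn.form_combination_right[OF v_dom L, where c = "-1"] by (simp add: bn_def D_def)
        also have "bn ?n ?\<psi> (D k) = bn ?n ?\<psi> ?v + (-1) * bn ?n ?\<psi> ?\<psi>"
          using Sn.form_combination_right[OF \<psi>_dom L, where c = "-1"] by (simp add: bn_def D_def)
        finally have 1: "bn ?n (D k) (D k) = bn ?n ?v ?v - bn ?n ?v ?\<psi> - bn ?n ?\<psi> ?v + bn ?n ?\<psi> ?\<psi>"
          by simp
        have 2: "ip (\<nu>s ?n) (D k) (D k) = ip (\<nu>s ?n) ?v ?v - 2 * ip (\<nu>s ?n) ?v ?\<psi> + ip (\<nu>s ?n) ?\<psi> ?\<psi>"
          unfolding D_def using L by (simp add: ip_diff_left ip_diff_right ip_commute[of _ ?\<psi> ?v])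
        show ?thesis
          unfolding 1 2 H_def bn_v[OF L(1)] bn_v[OF L(2)] ip_commute[of _ ?\<psi> ?v]
          by (simp add: algebra_simps)
      qed
      have upper: "\<forall>\<^sub>F k in sequentially. H k + bn (q k) (\<psi>s (q k)) (\<psi>s (q k)) < ?H + b \<psi> \<psi> + e" if e: "e > 0" for e
      proof -
        have "limsup (\<lambda>n. form (\<nu>s n) (Ts n) (\<psi>s n) (\<psi>s n)) < ereal (b \<psi> \<psi> + e/2)"
          using \<psi>s(3) form_b[OF \<psi>, of \<psi>] e by (auto intro: le_less_trans)
        then have "\<forall>\<^sub>F n in sequentially. form (\<nu>s n) (Ts n) (\<psi>s n) (\<psi>s n) < ereal (b \<psi> \<psi> + e/2)"
          by (rule Limsup_lessD)
        from eventually_subseq[OF q this]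
        have "\<forall>\<^sub>F k in sequentially. bn (q k) (\<psi>s (q k)) (\<psi>s (q k)) < b \<psi> \<psi> + e/2"
          by (simp add: form_bn[OF \<psi>_dom])
        moreover have "\<forall>\<^sub>F k in sequentially. H k < ?H + e/2"
          using e by (intro order_tendstoD(2)[OF H_lim]) simp
        ultimately show ?thesis by eventually_elim simp
      qed
      \<comment> \<open>Three errors of e/3: from (i) for the form of \<open>D\<close>, from lower
        semicontinuity of its norm, and from \<open>upper\<close>.\<close>
      have lower: "b ?\<chi> ?\<chi> + \<beta> * ip \<nu> ?\<chi> ?\<chi> \<le> ?H + b \<psi> \<psi>"
      proof (rule field_le_epsilon)
        fix e :: real assume e: "e > 0"
        have "ereal (b ?\<chi> ?\<chi> - e/3) < form \<nu> T ?\<chi> ?\<chi>"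
          using form_b[OF \<chi>_dom, of ?\<chi>] e by simp
        also have "\<dots> \<le> liminf (\<lambda>k. form (\<nu>s (q k)) (Ts (q k)) (D k) (D k))"
          by (rule i[OF \<chi>L q DC D_conv])
        finally have "ereal (b ?\<chi> ?\<chi> - e/3) < liminf (\<lambda>k. form (\<nu>s (q k)) (Ts (q k)) (D k) (D k))" .
        then have "\<forall>\<^sub>F k in sequentially. ereal (b ?\<chi> ?\<chi> - e/3) < form (\<nu>s (q k)) (Ts (q k)) (D k) (D k)"
          by (rule less_LiminfD)
        then have ev1: "\<forall>\<^sub>F k in sequentially. b ?\<chi> ?\<chi> - e/3 < bn (q k) (D k) (D k)"
          by (simp add: form_bn[OF D_dom])
        have C_sub_q: "C \<subseteq> norm_convergent_fns \<nu> (\<lambda>k. \<nu>s (q k))"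
        proof
          fix c assume c: "c \<in> C"
          with C_sub have "(\<lambda>n. ip (\<nu>s n) c c) \<longlonglongrightarrow> ip \<nu> c c" by (blast intro: norm_convergent_fnsD)
          from LIMSEQ_subseq_LIMSEQ[OF this q] show "c \<in> norm_convergent_fns \<nu> (\<lambda>k. \<nu>s (q k))"
            using CL[OF c] by (simp add: norm_convergent_fns_def o_def)
        qed
        have "e / (3 * \<beta>) > 0" using e \<beta> by simp
        from w_converges_norm_lower_bound[OF D_conv C_sub_q C1 this]
        have ev2: "\<forall>\<^sub>F k in sequentially. \<beta> * ip \<nu> ?\<chi> ?\<chi> - e/3 < \<beta> * ip (\<nu>s (q k)) (D k) (D k)"
        proof eventually_elim
          case (elim k)
          from mult_strict_left_mono[OF this \<beta>] \<beta> show ?case by (simp add: right_diff_distrib)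
        qed
        have "e/3 > 0" using e by simp
        from upper[OF this] ev1 ev2
        have "\<forall>\<^sub>F k in sequentially. b ?\<chi> ?\<chi> + \<beta> * ip \<nu> ?\<chi> ?\<chi> \<le> ?H + b \<psi> \<psi> + e"
        proof eventually_elim
          case (elim k)
          with expand[of k] show ?case by linarith
        qed
        then show "b ?\<chi> ?\<chi> + \<beta> * ip \<nu> ?\<chi> ?\<chi> \<le> ?H + b \<psi> \<psi> + e" by simp
      qed
      have "\<forall>\<^sub>F k in sequentially. \<beta> * ip (\<nu>s (q k)) (D k) (D k) < ?H + b \<psi> \<psi> + e" if "e > 0" for e
        using upper[OF that]
      proof eventually_elim
        case (elim k)
        have "0 \<le> bn (q k) (D k) (D k)" unfolding bn_def by (rule Sn.form_nonneg[OF D_dom])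
        with elim expand[of k] show ?case by linarith
      qed
      with \<psi>s(2) lower show ?thesis unfolding D_def by blast
    qed

    \<comment> \<open>The difference of the w-limit and the resolvent vanishes\<close>
    define \<eta> where "\<eta> = (\<lambda>x. \<phi> x + (-1) * u x)"
    have \<eta>_dom: "\<eta> \<in> form_dom \<nu> T" unfolding \<eta>_def by (rule S.form_dom_combination[OF \<phi>_dom u_dom])
    have \<eta>L: "\<eta> \<in> L2 \<nu>" using \<eta>_dom by (simp add: form_dom_def)
    have ip_\<phi>: "ip \<nu> w \<phi> = ip \<nu> w u + ip \<nu> w \<eta>" if "w \<in> L2 \<nu>" for w
      unfolding \<eta>_def using that \<phi>L uL by (simp add: ip_diff_right)
    define B where "B = b \<eta> \<eta> + \<beta> * ip \<nu> \<eta> \<eta>"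
    \<comment> \<open>For \<psi> = u + s \<eta> the difference \<phi> - \<psi> is (1 - s) \<eta>, so
      the left side of \<open>step\<close> is (1 - s)^2 B. By the resolvent equation for
      \<open>u\<close> the right side reduces to the pairing of g with \<eta> plus s^2 B.\<close>
    have B_le: "(1 - 2 * s) * B \<le> ip \<nu> g \<eta>" for s
    proof -
      let ?\<psi> = "\<lambda>x. u x + s * \<eta> x"
      have \<psi>_dom: "?\<psi> \<in> form_dom \<nu> T" by (rule S.form_dom_combination[OF u_dom \<eta>_dom])
      have \<psi>L: "?\<psi> \<in> L2 \<nu>" using uL \<eta>L by simp
      have \<chi>: "(\<lambda>x. \<phi> x + (-1) * (u x + s * \<eta> x)) = (\<lambda>x. \<eta> x + (- s) * \<eta> x)"
        by (simp add: \<eta>_def fun_eq_iff)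
      have left: "b ?\<psi> w = b u w + s * b \<eta> w" if "w \<in> L2 \<nu>" for w
        unfolding b_def using S.form_combination_left[OF u_dom \<eta>_dom that, of s] by simp
      have right: "b w ?\<psi> = b w u + s * b w \<eta>" if "w \<in> form_dom \<nu> T" for w
        unfolding b_def using S.form_combination_right[OF that uL \<eta>L, of s] by simp
      have "b (\<lambda>x. \<eta> x + (- s) * \<eta> x) (\<lambda>x. \<eta> x + (- s) * \<eta> x)
          = (1 - s) * b \<eta> (\<lambda>x. \<eta> x + (- s) * \<eta> x)"
        unfolding b_def using S.form_combination_left[OF \<eta>_dom \<eta>_dom, of "\<lambda>x. \<eta> x + (- s) * \<eta> x" "- s"] \<eta>L
        by (simp add: algebra_simps)
      also have "b \<eta> (\<lambda>x. \<eta> x + (- s) * \<eta> x) = (1 - s) * b \<eta> \<eta>"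
        unfolding b_def using S.form_combination_right[OF \<eta>_dom \<eta>L \<eta>L, of "- s"]
        by (simp add: algebra_simps)
      finally have b\<chi>: "b (\<lambda>x. \<eta> x + (- s) * \<eta> x) (\<lambda>x. \<eta> x + (- s) * \<eta> x) = (1 - s) * ((1 - s) * b \<eta> \<eta>)" .
      have ip\<chi>: "ip \<nu> (\<lambda>x. \<eta> x + (- s) * \<eta> x) (\<lambda>x. \<eta> x + (- s) * \<eta> x) = (1 - s) * ((1 - s) * ip \<nu> \<eta> \<eta>)"
      proof -
        have "(\<lambda>x. \<eta> x + (- s) * \<eta> x) = (\<lambda>x. (1 - s) * \<eta> x)" by (simp add: algebra_simps)
        then show ?thesis by (simp only: ip_scale_left ip_scale_right)
      qed
      have "b (\<lambda>x. \<eta> x + (- s) * \<eta> x) (\<lambda>x. \<eta> x + (- s) * \<eta> x)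
            + \<beta> * ip \<nu> (\<lambda>x. \<eta> x + (- s) * \<eta> x) (\<lambda>x. \<eta> x + (- s) * \<eta> x)
          \<le> ip \<nu> g \<phi> - ip \<nu> g ?\<psi> - (\<beta> * ip \<nu> ?\<psi> u + b ?\<psi> u) + \<beta> * ip \<nu> ?\<psi> ?\<psi> + b ?\<psi> ?\<psi>"
        using step[OF \<psi>_dom] unfolding \<chi> by blast
      then have "(1 - s) * ((1 - s) * b \<eta> \<eta>) + \<beta> * ((1 - s) * ((1 - s) * ip \<nu> \<eta> \<eta>))
          \<le> (ip \<nu> g u + ip \<nu> g \<eta>) - (ip \<nu> g u + s * ip \<nu> g \<eta>)
            - (\<beta> * (ip \<nu> u u + s * ip \<nu> u \<eta>) + (b u u + s * b \<eta> u))
            + \<beta> * (ip \<nu> u u + s * ip \<nu> u \<eta> + s * (ip \<nu> u \<eta> + s * ip \<nu> \<eta> \<eta>))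
            + (b u u + s * b u \<eta> + s * (b \<eta> u + s * b \<eta> \<eta>))"
        using uL \<eta>L gL unfolding b\<chi> ip\<chi> left[OF \<psi>L] left[OF uL] right[OF u_dom] right[OF \<eta>_dom] ip_\<phi>[OF gL(1)]
        by (simp add: ip_add_left ip_add_right ip_scale_left ip_scale_right ip_commute[of \<nu> \<eta> u])
      then show ?thesis
        unfolding B_def b_u[OF \<eta>L] by (simp add: algebra_simps)
    qed
    have "B \<le> 0"
    proof (rule ccontr)
      assume "\<not> B \<le> 0"
      \<comment> \<open>Chosen so that the factor 1 - 2 s, with s = (1 - t)/2, lifts the left side
        to one more than its upper bound.\<close>
      define t where "t = (ip \<nu> g \<eta> + 1) / B"
      have "t * B = ip \<nu> g \<eta> + 1" using \<open>\<not> B \<le> 0\<close> by (simp add: t_def)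
      moreover have "1 - 2 * ((1 - t) / 2) = t" by (simp add: field_simps)
      ultimately show False using B_le[of "(1 - t) / 2"] by (simp only:)
    qed
    moreover have "0 \<le> b \<eta> \<eta>" unfolding b_def by (rule S.form_nonneg[OF \<eta>_dom])
    ultimately have "\<beta> * ip \<nu> \<eta> \<eta> \<le> 0" by (simp add: B_def)
    then have "ip \<nu> \<eta> \<eta> = 0"
      using \<beta> ip_self_nonneg[of \<nu> \<eta>] by (simp add: mult_le_0_iff)
    then have \<eta>0: "nrm \<nu> \<eta> = 0" by (simp add: nrm_def)
    have ip_\<eta>: "ip \<nu> w \<eta> = 0" if "w \<in> L2 \<nu>" for w
      using ip_Cauchy_Schwarz[OF that \<eta>L] by (simp add: \<eta>0)
    have "ip \<nu> \<phi> c = ip \<nu> u c" if "c \<in> C" for c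
      using ip_\<phi>[OF CL(1)[OF that]] ip_\<eta>[OF CL(1)[OF that]] by (simp add: ip_commute[of \<nu> c])

    \<comment> \<open>Convergence of the norms along the subsequence\<close>
    moreover have "(\<lambda>k. ip (\<nu>s (q k)) (v (q k)) (v (q k))) \<longlonglongrightarrow> ip \<nu> u u"
    proof -
      obtain \<psi>s where \<psi>s: "s_converges C \<nu>s \<nu> \<psi>s u"
        and near: "\<And>e. e > 0 \<Longrightarrow> \<forall>\<^sub>F k in sequentially.
          \<beta> * ip (\<nu>s (q k)) (\<lambda>x. v (q k) x + (-1) * \<psi>s (q k) x) (\<lambda>x. v (q k) x + (-1) * \<psi>s (q k) x)
          < ip \<nu> g \<phi> - ip \<nu> g u - (\<beta> * ip \<nu> u u + b u u) + \<beta> * ip \<nu> u u + b u u + e"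
        using step[OF u_dom] by blast
      have \<psi>C: "\<psi>s n \<in> C" for n using \<psi>s by (simp add: s_converges_def w_converges_def)
      let ?d = "\<lambda>k. nrm (\<nu>s (q k)) (\<lambda>x. v (q k) x - \<psi>s (q k) x)"
      have "(\<lambda>k. (?d k)\<^sup>2) \<longlonglongrightarrow> 0"
      proof (rule tendstoI)
        fix e :: real assume e: "e > 0"
        have "\<beta> * e > 0" using e \<beta> by simp
        from near[OF this] show "\<forall>\<^sub>F k in sequentially. dist ((?d k)\<^sup>2) 0 < e"
        proof eventually_elim
          case (elim k)
          \<comment> \<open>For \<psi> = u the form terms in the bound of \<open>step\<close>
            cancel, leaving the pairing of g with \<eta>, which is 0, plus the error.\<close>
          then have "\<beta> * (?d k)\<^sup>2 < \<beta> * e"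
            using ip_\<phi>[OF gL(1)] ip_\<eta>[OF gL(1)] by (simp add: nrm_square)
          then show ?case using \<beta> by simp
        qed
      qed
      from tendsto_real_sqrt[OF this] have d_lim: "?d \<longlonglongrightarrow> 0" by simp
      have "(\<lambda>n. ip (\<nu>s n) (\<psi>s n) (\<psi>s n)) \<longlonglongrightarrow> ip \<nu> u u"
        using \<psi>s by (simp add: s_converges_def)
      from tendsto_real_sqrt[OF LIMSEQ_subseq_LIMSEQ[OF this q]]
      have \<psi>_lim: "(\<lambda>k. nrm (\<nu>s (q k)) (\<psi>s (q k))) \<longlonglongrightarrow> nrm \<nu> u" by (simp add: nrm_def o_def)
      have "(\<lambda>k. nrm (\<nu>s (q k)) (v (q k)) - nrm (\<nu>s (q k)) (\<psi>s (q k))) \<longlonglongrightarrow> 0"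
        by (rule Lim_null_comparison[OF always_eventually d_lim])
          (simp add: nrm_reverse_triangle[OF vL CL(2)[OF \<psi>C]])
      from tendsto_add[OF this \<psi>_lim] have "(\<lambda>k. nrm (\<nu>s (q k)) (v (q k))) \<longlonglongrightarrow> nrm \<nu> u" by simp
      from tendsto_power[OF this, of 2] show ?thesis by (simp add: nrm_square)
    qed
    ultimately show ?thesis by blast
  qed

  \<comment> \<open>From subsequences to the whole sequence\<close>
  have subsub: "\<exists>s :: nat \<Rightarrow> nat. strict_mono s \<and>
      (\<forall>c\<in>C. (\<lambda>k. ip (\<nu>s (r (s k))) (v (r (s k))) c) \<longlonglongrightarrow> ip \<nu> u c) \<and>
      (\<lambda>k. ip (\<nu>s (r (s k))) (v (r (s k))) (v (r (s k)))) \<longlonglongrightarrow> ip \<nu> u u"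
    if r: "strict_mono (r :: nat \<Rightarrow> nat)" for r
  proof -
    have "C \<subseteq> norm_convergent_fns \<nu> (\<lambda>k. \<nu>s (r k))"
    proof
      fix c assume c: "c \<in> C"
      with C_sub have "(\<lambda>n. ip (\<nu>s n) c c) \<longlonglongrightarrow> ip \<nu> c c" by (blast intro: norm_convergent_fnsD)
      from LIMSEQ_subseq_LIMSEQ[OF this r] show "c \<in> norm_convergent_fns \<nu> (\<lambda>k. \<nu>s (r k))"
        using CL[OF c] by (simp add: norm_convergent_fns_def o_def)
    qed
    from weakly_convergent_subsequence[OF prob(1) base C_linear this C1 vC v_bound]
    obtain s \<phi> where s: "strict_mono s"
      and conv: "w_converges C (\<lambda>k. \<nu>s (r (s k))) \<nu> (\<lambda>k. v (r (s k))) \<phi>" .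
    have "strict_mono (\<lambda>k. r (s k))" using strict_mono_o[OF r s] by (simp add: o_def)
    from identify[OF this conv] conv s show ?thesis
      unfolding w_converges_def by auto
  qed
  have "(\<lambda>n. ip (\<nu>s n) (v n) c) \<longlonglongrightarrow> ip \<nu> u c" if "c \<in> C" for c
    by (rule LIMSEQ_if_subsubsequence) (use subsub that in blast)
  moreover have "(\<lambda>n. ip (\<nu>s n) (v n) (v n)) \<longlonglongrightarrow> ip \<nu> u u"
    by (rule LIMSEQ_if_subsubsequence) (use subsub in blast)
  ultimately show "s_converges C \<nu>s \<nu> v (resolvent \<nu> T \<beta> g)"
    using vC uL unfolding s_converges_def w_converges_def u_def by blast
qed

end
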